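(* Let $d\ge 2$ and let $(Z(t))_{t\ge0}$ be the spherically symmetric continuous-time conservative walk (Model B) on $\mathbb{R}^d$ whose rate function is either (i) $\lambda(t)=t^{-\alpha}$, $t>0$, with $\alpha\in(0,1)$; or (ii) $\lambda(t)=(\ln t)^{-\beta}$ for $t\ge e$ and $\lambda(t)=0$ otherwise, with $\beta>2$. Then $Z(t)$ is transient almost surely.
   Context: Model B (spherically symmetric conservative walk, "random flight") on $\mathbb{R}^d$: Let $\lambda\ge 0$ be a rate function with $\Lambda(T)=\int_0^T\lambda(t)\,dt<\infty$ for all $T\ge 0$ and $\Lambda(T)\to\infty$ as $T\to\infty$. Let $\tau_0=0$ and let $\tau_1<\tau_2<\dots$ be the consecutive points of a non-homogeneous Poisson point process on $[0,\infty)$ with rate $\lambda(t)$. Let $\mathbf f_0,\mathbf f_1,\mathbf f_2,\dots$ be i.i.d. random vectors, independent of $(\tau_k)_{k\ge1}$, each uniformly distributed on the unit sphere $\mathcal S^{d-1}$ of $\mathbb{R}^d$. With $N(t)=\sup\{k\ge 0:\tau_k\le t\}$, the walk is $$Z(t)=\sum_{k=0}^{N(t)-1}(\tau_{k+1}-\tau_k)\mathbf f_k+(t-\tau_{N(t)})\mathbf f_{N(t)},\qquad t\ge 0.$$ Transience: for $\rho\ge 0$, $Z(t)$ is $\rho$-recurrent if there is an infinite sequence of times $t_1<t_2<\dots$ converging to infinity with $Z(t_i)\in[-\rho,\rho]^d$ for all $i$. $Z(t)$ is transient if it is not $\rho$-recurrent for any $\rho>0$, equivalently $\lim_{t\to\infty}\|Z(t)\|=\infty$.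 *)

theory Defs
  imports "HOL-Probability.Probability"
begin

text \<open>
  The normalised surface measure of the unit sphere, as the cone measure: the mass of a Borel set
  of directions is the relative volume of the part of the unit ball lying over it. It is realised
  as a Borel measure on the whole space which is carried by the sphere. (The radial projection
  \<^term>\<open>sgn\<close> sends the origin to the origin, but that is a null event.)
\<close>

definition uniform_sphere :: "(real ^ 'n) measure" where
  "uniform_sphere = distr (uniform_measure lborel (ball 0 1)) borel sgn"

lemma prob_space_uniform_sphere: "prob_space (uniform_sphere :: (real ^ 'n) measure)"
proof -
  have "emeasure lborel (ball (0::real^'n) 1) \<noteq> 0"
    using emeasure_lborel_ball_finite[of "0::real^'n" 1] content_ball_pos[of 1 "0::real^'n"]
    by (simp add: emeasure_eq_ennreal_measure)
  moreover have "emeasure lborel (ball (0::real^'n) 1) \<noteq> \<infinity>"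
    using emeasure_lborel_ball_finite[of "0::real^'n" 1] by simp
  ultimately interpret prob_space "uniform_measure lborel (ball (0::real^'n) 1)"
    by (rule prob_space_uniform_measure)
  show ?thesis
    unfolding uniform_sphere_def by (rule prob_space_distr) simp
qed

lemma AE_uniform_sphere: "AE x in (uniform_sphere :: (real ^ 'n) measure). x \<in> sphere 0 1"
proof -
  have "AE x in lborel. (x::real^'n) \<noteq> 0"
    by (rule AE_lborel_singleton)
  then have "AE x in uniform_measure lborel (ball (0::real^'n) 1). sgn x \<in> sphere 0 1"
    by (intro AE_uniform_measureI) (auto simp: norm_sgn)
  then show ?thesis
    unfolding uniform_sphere_def by (subst AE_distr_iff) (auto simp: norm_sgn)
qed

text \<open>
  The index type is a well-order here only because \<open>measure_orthogonal_image\<close> requires it.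
\<close>

lemma uniform_sphere_orthogonal:
  fixes T :: "(real, 'n::{finite,wellorder}) vec \<Rightarrow> (real, 'n) vec"
  assumes T: "orthogonal_transformation T"
  shows "distr uniform_sphere borel T = uniform_sphere"
proof (rule measure_eqI)
  fix A assume "A \<in> sets (distr uniform_sphere borel T)"
  then have A: "A \<in> sets borel" by simp
  have "linear T" using T by (simp add: orthogonal_transformation_linear)
  then have mT [measurable]: "T \<in> borel_measurable borel"
    by (intro borel_measurable_continuous_onI linear_continuous_on linear_conv_bounded_linear[THEN iffD1])
  have sgnT: "sgn (T x) = T (sgn x)" for x
    using T by (simp add: sgn_div_norm orthogonal_transformation_norm linear_scale[OF \<open>linear T\<close>])
  have *: "emeasure uniform_sphere B = emeasure lborel (ball 0 1 \<inter> sgn -` B) / emeasure lborel (ball (0::(real,'n) vec) 1)"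
    if "B \<in> sets borel" for B :: "((real,'n) vec) set"
  proof -
    have "(sgn -` B :: ((real,'n) vec) set) \<in> sets borel"
      using measurable_sets[of sgn "borel :: ((real,'n) vec) measure" borel B] that by simp
    then show ?thesis
      using that by (simp add: uniform_sphere_def emeasure_distr)
  qed
  let ?S = "ball 0 1 \<inter> sgn -` (T -` A) :: ((real,'n) vec) set"
  have TA: "T -` A \<in> sets borel" using measurable_sets[OF mT A] by simp
  have S: "?S \<in> sets borel"
    using measurable_sets[of sgn "borel :: ((real,'n) vec) measure" borel "T -` A"] TA by simp
  have S': "(ball 0 1 \<inter> sgn -` A :: ((real,'n) vec) set) \<in> sets borel"
    using measurable_sets[of sgn "borel :: ((real,'n) vec) measure" borel A] A by simp
  have fin: "emeasure lborel X < \<infinity>" if "X \<subseteq> ball 0 1" for X :: "((real,'n) vec) set"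
    using that bounded_subset[OF bounded_ball] by (intro emeasure_bounded_finite) auto
  have "T ` ?S = ball 0 1 \<inter> sgn -` A"
  proof
    show "T ` ?S \<subseteq> ball 0 1 \<inter> sgn -` A"
      using T by (auto simp: sgnT orthogonal_transformation_norm)
    show "ball 0 1 \<inter> sgn -` A \<subseteq> T ` ?S"
    proof
      fix y assume y: "y \<in> ball 0 1 \<inter> sgn -` A"
      obtain x where "y = T x" using orthogonal_transformation_surj[OF T] by (metis surjD)
      with y T show "y \<in> T ` ?S"
        by (intro image_eqI[of _ _ x]) (auto simp flip: sgnT simp: orthogonal_transformation_norm)
    qed
  qed
  moreover have "?S \<in> lmeasurable"
    using S fin[of ?S] by (intro fmeasurableI) auto
  ultimately have "measure lebesgue (ball 0 1 \<inter> sgn -` A) = measure lebesgue ?S"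
    using measure_orthogonal_image[OF T, of ?S] by simp
  then have "emeasure lborel (ball 0 1 \<inter> sgn -` A) = emeasure lborel ?S"
    using S S' fin[of ?S] fin[of "ball 0 1 \<inter> sgn -` A"]
    by (simp add: emeasure_eq_ennreal_measure less_top)
  moreover have "emeasure (distr uniform_sphere borel T) A = emeasure uniform_sphere (T -` A)"
    using A mT by (subst emeasure_distr) (auto simp: uniform_sphere_def)
  ultimately show "emeasure (distr uniform_sphere borel T) A = emeasure uniform_sphere A"
    using *[OF A] *[OF TA] by simp
qed (simp add: uniform_sphere_def)

definition rate_function :: "(real \<Rightarrow> real) \<Rightarrow> bool" where
  "rate_function r \<longleftrightarrow>
     (\<forall>t\<ge>0. 0 \<le> r t) \<and>
     (\<forall>T\<ge>0. set_integrable lborel {0..T} r) \<and>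
     filterlim (\<lambda>T. LINT t:{0..T}|lborel. r t) at_top at_top"

text \<open>
  The time \<open>\<tau> 0\<close> is the start of the walk; the points of the point process are \<open>\<tau> k\<close> with \<open>k \<ge> 1\<close>.
\<close>

definition point_count :: "(nat \<Rightarrow> 'w \<Rightarrow> real) \<Rightarrow> real set \<Rightarrow> 'w \<Rightarrow> nat" where
  "point_count \<tau> A \<omega> = card {k. 1 \<le> k \<and> \<tau> k \<omega> \<in> A}"

text \<open>
  The assumption \<open>locally_finite\<close> makes the set counted by \<^const>\<open>point_count\<close> almost surely finite
  for bounded \<open>A\<close>. The Poisson weights are written out because \<open>poisson_pmf\<close> excludes mean zero,
  which occurs when the rate vanishes on \<open>A\<close>. Finite disjoint families are covered by padding
  with empty sets.
\<close>

locale poisson_point_process = prob_space M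
  for M :: "'w measure" and r :: "real \<Rightarrow> real" and \<tau> :: "nat \<Rightarrow> 'w \<Rightarrow> real" +
  assumes points_measurable: "\<And>k. random_variable borel (\<tau> k)"
    and points_nonneg: "AE \<omega> in M. 0 \<le> \<tau> 1 \<omega>"
    and points_increasing: "AE \<omega> in M. strict_mono_on {1..} (\<lambda>k. \<tau> k \<omega>)"
    and locally_finite: "AE \<omega> in M. filterlim (\<lambda>k. \<tau> k \<omega>) at_top sequentially"
    and count_poisson:
      "\<And>A n. \<lbrakk>A \<in> sets borel; bounded A; A \<subseteq> {0..}\<rbrakk> \<Longrightarrow>
         prob {\<omega> \<in> space M. point_count \<tau> A \<omega> = n} =
           (LINT t:A|lborel. r t) ^ n / fact n * exp (- (LINT t:A|lborel. r t))"
    and count_indep: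
      "\<And>A :: nat \<Rightarrow> real set.
         \<lbrakk>\<And>i. A i \<in> sets borel; \<And>i. bounded (A i); \<And>i. A i \<subseteq> {0..}; disjoint_family A\<rbrakk> \<Longrightarrow>
         indep_vars (\<lambda>_. count_space UNIV) (\<lambda>i. point_count \<tau> (A i)) UNIV"

text \<open>
  The independence of the two sequences is expressed through the \<open>\<sigma>\<close>-algebras they generate,
  since the library's \<open>indep_var\<close> needs both variables to take values in the same type.
\<close>

locale random_flight = poisson_point_process M r \<tau>
  for M :: "'w measure" and r :: "real \<Rightarrow> real" and \<tau> :: "nat \<Rightarrow> 'w \<Rightarrow> real" +
  fixes f :: "nat \<Rightarrow> 'w \<Rightarrow> real ^ 'n"
  assumes rate: "rate_function r"
    and start: "\<And>\<omega>. \<omega> \<in> space M \<Longrightarrow> \<tau> 0 \<omega> = 0"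
    and directions_indep: "indep_vars (\<lambda>_. borel) f UNIV"
    and directions_uniform: "\<And>k. distr M borel (f k) = uniform_sphere"
    and directions_indep_points:
      "indep_set
         (sets (vimage_algebra (space M) (\<lambda>\<omega> k. f k \<omega>) (\<Pi>\<^sub>M k\<in>UNIV. borel)))
         (sets (vimage_algebra (space M) (\<lambda>\<omega>. \<lambda>k\<in>{1..}. \<tau> k \<omega>) (\<Pi>\<^sub>M k\<in>{1..}. borel)))"

definition turns :: "(nat \<Rightarrow> 'w \<Rightarrow> real) \<Rightarrow> real \<Rightarrow> 'w \<Rightarrow> nat" where
  "turns \<tau> t \<omega> = Sup {k. \<tau> k \<omega> \<le> t}"

definition walk ::
  "(nat \<Rightarrow> 'w \<Rightarrow> real) \<Rightarrow> (nat \<Rightarrow> 'w \<Rightarrow> real ^ 'n) \<Rightarrow> real \<Rightarrow> 'w \<Rightarrow> real ^ 'n" where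
  "walk \<tau> f t \<omega> =
     (\<Sum>k<turns \<tau> t \<omega>. (\<tau> (Suc k) \<omega> - \<tau> k \<omega>) *\<^sub>R f k \<omega>) +
     (t - \<tau> (turns \<tau> t \<omega>) \<omega>) *\<^sub>R f (turns \<tau> t \<omega>) \<omega>"

definition recurrent_path :: "real \<Rightarrow> (real \<Rightarrow> real ^ 'n) \<Rightarrow> bool" where
  "recurrent_path \<rho> z \<longleftrightarrow>
     (\<exists>t :: nat \<Rightarrow> real. strict_mono t \<and> (\<forall>i. 0 \<le> t i) \<and> filterlim t at_top sequentially \<and>
        (\<forall>i. z (t i) \<in> cbox (\<chi> j. - \<rho>) (\<chi> j. \<rho>)))"

definition transient_path :: "(real \<Rightarrow> real ^ 'n) \<Rightarrow> bool" where
  "transient_path z \<longleftrightarrow> \<not> (\<exists>\<rho>>0. recurrent_path \<rho> z)"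

end

theory Submission
  imports Defs "HOL-Real_Asymp.Real_Asymp"
begin

text \<open>
  The walk has speed one, so if it meets a cube around the origin at some time, it is within a
  slightly larger ball at the next integer time. By Borel-Cantelli it suffices that for every \<open>R\<close>
  the probabilities \<open>P(\<parallel>Z(n)\<parallel> \<le> R)\<close> are summable over the integers \<open>n\<close>. Heuristically \<open>Z(n)\<close> is a
  sum of about \<open>n / h\<close> independent isotropic steps of length about \<open>h = 1 / \<lambda>(n)\<close>, so that its
  variance is of order \<open>n h\<close>, and two coordinates already give \<open>P(\<parallel>Z(n)\<parallel> \<le> R) = O(1 / (n h))\<close>. With
  \<open>h = n\<^sup>\<alpha>\<close> or \<open>h = (ln n)\<^sup>\<beta>\<close> this is summable. Three ingredients make the heuristic rigorous.

  \<^bold>\<open>One step.\<close> The characteristic function of the uniform distribution on the sphere satisfies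
  \<open>|J(v)| \<le> exp (- c min(1, \<parallel>v\<parallel>\<^sup>2))\<close> (\<open>uniform_sphere_char_bound\<close>). It is an average of
  \<open>cis (v \<bullet> sgn x)\<close> over the unit ball, and moving \<open>x\<close> a little in the direction of \<open>v\<close> changes the
  phase by a controlled amount on a small ball of points \<open>x\<close> nearly orthogonal to \<open>v\<close>. On that ball
  there is cancellation.

  \<^bold>\<open>Fixed step lengths.\<close> If at least \<open>n\<close> of the step lengths are at least \<open>a\<close>, the sum of the steps is
  within \<open>R\<close> of the origin with probability at most \<open>C\<^sub>R (exp (- c n) + 1 / (2 c n a\<^sup>2))\<close>
  (\<open>small_ball_fixed_steps\<close>). The indicator of \<open>\<parallel>z\<parallel> \<le> R\<close> is dominated by a multiple of a Gaussian
  function of two coordinates of \<open>z\<close>. A Gaussian function is itself a Gaussian average of characters,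
  so its expectation is a Gaussian average of the characteristic function of the sum.

  \<^bold>\<open>Many long steps.\<close> Cut \<open>[n/2, n]\<close> into blocks of length \<open>h\<close>. A block containing a point of the
  process, followed by an empty block, forces a step of length at least \<open>h\<close>. Disjoint pairs of blocks
  are independent and each has this property with probability bounded below. Hence, outside an event
  of probability \<open>exp (- \<delta> n / h)\<close>, a positive fraction of the pairs has it
  (\<open>prob_few_gap_starts_le\<close>). Since directions and turning times are independent, one can condition
  on the times and apply the bound for fixed step lengths (\<open>prob_near_origin_le\<close>).
\<close>

section \<open>The characteristic function of the uniform distribution on the sphere\<close>

text \<open>
  Here \<open>y / sqrt (y\<^sup>2 + q)\<close> is the component of the direction of a vector along a unit axis, where
  \<open>y\<close> is the component of the vector along that axis and \<open>q\<close> the squared length of the rest. As long as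
  the rest is neither too short nor too long, this component moves at a speed comparable to that of \<open>y\<close>.
\<close>

lemma radial_derivative:
  fixes q y :: real assumes q: "1/16 \<le> q" "q \<le> 1" and y: "\<bar>y\<bar> \<le> 1/4"
  shows "\<exists>D. ((\<lambda>y. y / sqrt (y\<^sup>2 + q)) has_real_derivative D) (at y) \<and> 1/64 \<le> D \<and> D \<le> 4"
proof -
  define z where "z = sqrt (y\<^sup>2 + q)"
  have y2: "y\<^sup>2 \<le> 1/16" using y abs_le_square_iff[of y "1/4"] by (simp add: power2_eq_square)
  have zz: "z\<^sup>2 = y\<^sup>2 + q" using q by (simp add: z_def)
  have z1: "1/4 \<le> z" unfolding z_def using q by (intro real_le_rsqrt) (simp add: power_divide, use zero_le_power2[of y] in linarith)
  have z2: "z \<le> 2" unfolding z_def using q y2 by (intro real_le_lsqrt) auto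
  have D: "((\<lambda>y. y / sqrt (y\<^sup>2 + q)) has_real_derivative q / z^3) (at y)"
  proof -
    have pos: "y\<^sup>2 + q > 0" using q by (simp add: add_nonneg_pos)
    have "((\<lambda>y. y / sqrt (y\<^sup>2 + q)) has_real_derivative (z - y * (y / z)) / (z * z)) (at y)"
      unfolding z_def using pos 
      by (auto intro!: derivative_eq_intros simp: divide_simps)
    also have "(z - y * (y / z)) / (z * z) = q / z^3"
      using z1 zz by (simp add: field_simps power2_eq_square power3_eq_cube)
    finally show ?thesis .
  qed
  have z3: "z^3 \<le> 4" 
  proof -
    have "z^3 = z * z\<^sup>2" by (simp add: power2_eq_square power3_eq_cube)
    also have "\<dots> \<le> 2 * (1/16+1)" using z1 z2 zz y2 q by (intro mult_mono) auto
    finally show ?thesis by simp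
  qed
  have z3': "z^3 > 0" using z1 by simp
  have "1/64 \<le> q / z^3" using z3 z3' q by (simp add: field_simps)
  moreover have "q / z^3 \<le> 4"
  proof -
    have "q \<le> z\<^sup>2" using zz by simp
    also have "z\<^sup>2 * 1 \<le> z\<^sup>2 * (4 * z)" using z1 by (intro mult_left_mono) auto
    finally have "q \<le> 4 * z^3" by (simp add: power2_eq_square power3_eq_cube)
    thus ?thesis using z3' by (simp add: field_simps)
  qed
  ultimately show ?thesis using D by blast
qed

text \<open>
  Points near \<open>p\<close> are far from the axis spanned by \<open>w\<close>, so translating them along \<open>w\<close> turns their
  direction towards \<open>w\<close> at a speed bounded above and below.
\<close>

lemma direction_increment:
  fixes X w p :: "'a::euclidean_space"
  assumes w: "norm w = 1" and p: "p \<bullet> w = 0" "norm p = 1/2" and X: "dist p X < 1/8"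
    and h: "0 \<le> h" "h \<le> 1/8"
  shows "h / 64 \<le> w \<bullet> sgn (X + h *\<^sub>R w) - w \<bullet> sgn X" "w \<bullet> sgn (X + h *\<^sub>R w) - w \<bullet> sgn X \<le> 4 * h"
proof -
  define a where "a = w \<bullet> X"
  define q where "q = (norm X)\<^sup>2 - a\<^sup>2"
  have ww: "w \<bullet> w = 1" using w by (simp add: dot_square_norm)
  have "\<bar>w \<bullet> (X - p)\<bar> \<le> norm w * norm (X - p)" by (rule Cauchy_Schwarz_ineq2)
  then have a: "\<bar>a\<bar> \<le> 1/8" using X w p by (simp add: a_def inner_diff_right inner_commute dist_norm norm_minus_commute)
  have qn: "q = (norm (X - a *\<^sub>R w))\<^sup>2"
    unfolding q_def power2_norm_eq_inner
    by (simp add: inner_diff_left inner_diff_right ww a_def inner_commute power2_eq_square)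
  have "norm p \<le> norm (X - a *\<^sub>R w) + norm (p - X) + norm (a *\<^sub>R w)"
    using norm_triangle_ineq[of "X - a *\<^sub>R w" "p - X"] norm_triangle_ineq[of "X - a *\<^sub>R w + (p - X)" "a *\<^sub>R w"] by simp
  then have q1: "1/4 \<le> norm (X - a *\<^sub>R w)" using p X a w by (simp add: dist_norm)
  have q1': "1/16 \<le> q" using power_mono[OF q1, of 2] by (simp add: qn power2_eq_square)
  have "norm X \<le> norm p + norm (X - p)" using norm_triangle_ineq[of p "X - p"] by simp
  then have "norm X \<le> 1" using p X by (simp add: dist_norm norm_minus_commute)
  then have q2: "q \<le> 1" using power_mono[of "norm X" 1 2] by (simp add: q_def) (smt (verit) zero_le_power2)
  have ns: "w \<bullet> sgn (X + u *\<^sub>R w) = (a+u) / sqrt ((a+u)\<^sup>2 + q)" for u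
  proof -
    have "(norm (X + u *\<^sub>R w))\<^sup>2 = (a+u)\<^sup>2 + q"
      unfolding q_def power2_norm_eq_inner
      by (simp add: a_def inner_add_left inner_add_right ww inner_commute power2_eq_square algebra_simps)
    then have "norm (X + u *\<^sub>R w) = sqrt ((a+u)\<^sup>2 + q)" by (metis norm_ge_zero real_sqrt_unique)
    then show ?thesis by (simp add: sgn_div_norm inner_add_right ww a_def add_divide_distrib divide_inverse algebra_simps)
  qed
  define \<phi> where "\<phi> = (\<lambda>y. y / sqrt (y\<^sup>2 + q))"
  have "\<exists>D. 1/64 \<le> D \<and> D \<le> 4 \<and> \<phi> (a + h) - \<phi> a = h * D"
  proof (cases "h = 0")
    case True thus ?thesis by (intro exI[of _ 1]) simp
  next
    case False
    have "\<exists>D. (\<phi> has_real_derivative D) (at y) \<and> 1/64 \<le> D \<and> D \<le> 4" if "a \<le> y" "y \<le> a + h" for y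
      unfolding \<phi>_def by (rule radial_derivative) (use that a h q1' q2 in auto)
    then obtain D where D: "\<And>y. a \<le> y \<Longrightarrow> y \<le> a + h \<Longrightarrow> (\<phi> has_real_derivative D y) (at y) \<and> 1/64 \<le> D y \<and> D y \<le> 4"
      by metis
    obtain z where "a < z" "z < a+h" "\<phi> (a+h) - \<phi> a = (a + h - a) * D z"
      using MVT2[of a "a+h" \<phi> D] D False h by auto
    thus ?thesis using D[of z] by auto
  qed
  then obtain D where D: "1/64 \<le> D" "D \<le> 4" "\<phi> (a + h) - \<phi> a = h * D" by blast
  have e: "w \<bullet> sgn (X + h *\<^sub>R w) - w \<bullet> sgn X = h * D"
    using ns[of h] ns[of 0] D(3) by (simp add: \<phi>_def)
  show "h / 64 \<le> w \<bullet> sgn (X + h *\<^sub>R w) - w \<bullet> sgn X" "w \<bullet> sgn (X + h *\<^sub>R w) - w \<bullet> sgn X \<le> 4 * h"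
    unfolding e using D h mult_left_mono[of "1/64" D h] mult_left_mono[of D 4 h] by (auto simp: mult.commute)
qed

lemma integral_uniform_sphere:
  fixes g :: "real ^ 'n \<Rightarrow> complex"
  assumes [measurable]: "g \<in> borel_measurable borel"
  shows "(\<integral>x. g x \<partial>uniform_sphere) =
         (\<integral>x. indicator (ball 0 1) x *\<^sub>R g (sgn x) \<partial>lborel) /\<^sub>R measure lborel (ball (0 :: real ^ 'n) 1)"
proof -
  let ?B = "ball 0 1 :: (real ^ 'n) set"
  have [measurable]: "(\<lambda>x. indicator ?B x / measure lborel ?B :: real) \<in> borel_measurable borel"
    by (intro borel_measurable_divide borel_measurable_indicator) auto
  have V: "emeasure lborel ?B = ennreal (measure lborel ?B)" "0 < measure lborel ?B"
    using emeasure_lborel_ball_finite[of "0::real^'n" 1] content_ball_pos[of 1 "0::real^'n"]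
    by (auto simp: emeasure_eq_ennreal_measure)
  have "uniform_measure lborel ?B = density lborel (\<lambda>x. ennreal (indicator ?B x / measure lborel ?B))"
    unfolding uniform_measure_def using V
    by (intro density_cong) (auto simp: indicator_def divide_ennreal[of 1, simplified])
  then have "(\<integral>x. g x \<partial>uniform_sphere) = (\<integral>x. (indicator ?B x / measure lborel ?B) *\<^sub>R g (sgn x) \<partial>lborel)"
    unfolding uniform_sphere_def by (simp add: integral_distr) (subst integral_density; simp)
  also have "\<dots> = (\<integral>x. inverse (measure lborel ?B) *\<^sub>R (indicator ?B x *\<^sub>R g (sgn x)) \<partial>lborel)"
    by (simp add: divide_inverse mult.commute)
  finally show ?thesis by (simp del: scaleR_scaleR)
qed

lemma norm_integral_indicator_le:
  fixes g :: "'a \<Rightarrow> complex"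
  assumes [measurable]: "g \<in> borel_measurable M" "A \<in> sets M" and A: "emeasure M A < \<infinity>"
    and C: "\<And>x. x \<in> A \<Longrightarrow> norm (g x) \<le> C" "0 \<le> C"
  shows "integrable M (\<lambda>x. indicator A x *\<^sub>R g x)"
    "norm (\<integral>x. indicator A x *\<^sub>R g x \<partial>M) \<le> C * measure M A"
proof -
  have i: "integrable M (\<lambda>x. C * indicator A x :: real)"
    using A by (intro integrable_mult_right) simp
  show "integrable M (\<lambda>x. indicator A x *\<^sub>R g x)"
    by (rule Bochner_Integration.integrable_bound[OF i]) (use C in \<open>auto simp: indicator_def\<close>)
  then have "(\<integral>x. norm (indicator A x *\<^sub>R g x) \<partial>M) \<le> (\<integral>x. C * indicator A x \<partial>M)"
    using i C by (intro integral_mono integrable_norm) (auto simp: indicator_def)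
  then have "norm (\<integral>x. indicator A x *\<^sub>R g x \<partial>M) \<le> (\<integral>x. C * indicator A x \<partial>M)"
    using integral_norm_bound[of M "\<lambda>x. indicator A x *\<^sub>R g x"] by linarith
  then show "norm (\<integral>x. indicator A x *\<^sub>R g x \<partial>M) \<le> C * measure M A"
    using A by simp
qed

lemma cos_le_quadratic:
  fixes x :: real
  assumes "0 \<le> x" "x \<le> 1"
  shows "cos x \<le> 1 - x\<^sup>2 / 8"
proof -
  have "x / 2 / 2 \<le> sin (x / 2)"
  proof (cases "x = 0")
    case False
    have "\<exists>z. 0 < z \<and> z < x/2 \<and> sin (x/2) - sin 0 = (x/2 - 0) * cos z"
      by (rule MVT2) (use assms False in \<open>auto intro!: derivative_eq_intros\<close>)
    then obtain z where z: "0 < z" "z < x/2" "sin (x/2) = (x/2) * cos z" by auto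
    have "cos (pi/3) \<le> cos z" using z assms pi_gt3 by (intro cos_monotone_0_pi_le) auto
    then have "(x/2) * (1/2) \<le> (x/2) * cos z" using assms by (intro mult_left_mono) (auto simp: cos_60)
    then show ?thesis using z(3) by linarith
  qed simp
  then have "(x/4)\<^sup>2 \<le> (sin (x/2))\<^sup>2" using assms by (intro power_mono) auto
  moreover have "cos x = 1 - 2 * (sin (x/2))\<^sup>2" using cos_double_sin[of "x/2"] by simp
  ultimately show ?thesis by (simp add: power_divide)
qed

text \<open>
  Two unit complex numbers with distinct, but not too distant, phases cancel partially.
\<close>

lemma norm_cis_add_cis:
  assumes "\<delta>\<^sub>0 \<le> b - a" "b - a \<le> 1" "0 \<le> \<delta>\<^sub>0"
  shows "norm (cis a + cis b) \<le> 2 - \<delta>\<^sub>0\<^sup>2 / 16"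
proof -
  have d: "\<delta>\<^sub>0 \<le> 1" using assms by simp
  have "(norm (cis a + cis b))\<^sup>2 =
      ((sin a)\<^sup>2 + (cos a)\<^sup>2) + ((sin b)\<^sup>2 + (cos b)\<^sup>2) + 2 * cos (b - a)"
    by (simp add: cmod_power2 power2_sum cos_diff algebra_simps del: sin_cos_squared_add sin_cos_squared_add2)
  also have "\<dots> = 2 + 2 * cos (b - a)" by simp
  also have "cos (b - a) \<le> cos \<delta>\<^sub>0"
    using assms pi_gt3 by (intro cos_monotone_0_pi_le) auto
  also have "cos \<delta>\<^sub>0 \<le> 1 - \<delta>\<^sub>0\<^sup>2 / 8" using assms by (intro cos_le_quadratic) auto
  finally have "(norm (cis a + cis b))\<^sup>2 \<le> 4 - \<delta>\<^sub>0\<^sup>2 / 4" by simp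
  also have "\<dots> \<le> (2 - \<delta>\<^sub>0\<^sup>2 / 16)\<^sup>2" by (simp add: power2_diff)
  finally show ?thesis
    by (rule power2_le_imp_le) (use power_mono[of \<delta>\<^sub>0 1 2] d assms in auto)
qed

text \<open>
  The quantity in question is the average of \<open>F x = cis (v \<bullet> sgn x)\<close> over the unit ball \<open>B\<close>. Let \<open>Q\<close> be
  a small ball around a point orthogonal to \<open>v\<close>, which exists since the dimension is at least two, and
  let \<open>Q'\<close> be its translate by a vector parallel to \<open>v\<close>. Averaging the two splittings
  \<open>B = (B - Q) \<union> Q\<close> and \<open>B = (B - Q') \<union> Q'\<close> pairs \<open>F x\<close> with the value of \<open>F\<close> at the translate of \<open>x\<close>, for
  \<open>x \<in> Q\<close>. The phases of the two values differ by an amount of order \<open>min(1, \<parallel>v\<parallel>)\<close>. This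
  treats small and large \<open>v\<close> at once.
\<close>

lemma uniform_sphere_char_bound:
  assumes dim: "CARD('n) \<ge> 2"
  shows "\<exists>c>0. \<forall>v :: real ^ 'n.
     norm (\<integral>x. cis (v \<bullet> x) \<partial>uniform_sphere) \<le> exp (- c * min 1 ((norm v)\<^sup>2))"
proof -
  define B where "B = (ball 0 1 :: (real ^ 'n) set)"
  define V where "V = measure lborel B"
  define \<kappa> where "\<kappa> = measure lborel (ball (0::real ^ 'n) (1/8)) / V"
  have V: "V > 0" using content_ball_pos[of 1 "0::real^'n"] by (simp add: V_def B_def)
  have \<kappa>: "\<kappa> > 0" using V content_ball_pos[of "1/8" "0::real^'n"] by (simp add: \<kappa>_def)
  have Q: "measure lborel (ball p (1/8)) = \<kappa> * V" for p :: "real ^ 'n"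
    using V by (simp add: \<kappa>_def content_ball)
  define c where "c = \<kappa> / (32 * 512\<^sup>2)"
  have "norm (\<integral>x. cis (v \<bullet> x) \<partial>uniform_sphere) \<le> exp (- c * min 1 ((norm v)\<^sup>2))" for v :: "real ^ 'n"
  proof (cases "v = 0")
    case True
    interpret prob_space "uniform_sphere :: (real ^ 'n) measure" by (rule prob_space_uniform_sphere)
    show ?thesis using True by (simp add: prob_space)
  next
    case False
    define s where "s = norm v"
    define w where "w = v /\<^sub>R s"
    have s: "s > 0" using False by (simp add: s_def)
    have w: "norm w = 1" "v = s *\<^sub>R w" using s by (simp_all add: w_def s_def)
    obtain y :: "real ^ 'n" where y: "y \<noteq> 0" "orthogonal w y"
      using orthogonal_to_vector_exists[of w] dim by auto
    define p where "p = (1 / (2 * norm y)) *\<^sub>R y"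
    have p: "p \<bullet> w = 0" "norm p = 1/2" using y by (simp_all add: p_def orthogonal_def inner_commute)
    \<comment> \<open>The bound \<open>1 / (4 s)\<close> keeps the phase difference below one, the bound \<open>1 / 8\<close> keeps the
      translate inside the unit ball.\<close>
    define h where "h = min (1/8) (1 / (4 * s))"
    have h: "0 < h" "h \<le> 1/8" "4 * s * h \<le> 1" using s by (auto simp: h_def min_def field_simps)
    have sh: "min 1 s / 8 \<le> s * h" using s by (auto simp: h_def min_def field_simps)
    define Q where "Q = ball p (1/8)"
    define Q' where "Q' = ball (p + h *\<^sub>R w) (1/8)"
    have sub: "Q \<subseteq> B" "Q' \<subseteq> B"
    proof -
      have "norm x < 1" if "dist p x < 1/8" for x
        using norm_triangle_ineq[of p "x - p"] p that by (simp add: dist_norm norm_minus_commute)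
      then show "Q \<subseteq> B" by (auto simp: Q_def B_def)
      have "norm x < 1" if "dist (p + h *\<^sub>R w) x < 1/8" for x
        using norm_triangle_ineq[of "p + h *\<^sub>R w" "x - (p + h *\<^sub>R w)"] norm_triangle_ineq[of p "h *\<^sub>R w"] p that h w
        by (simp add: dist_norm norm_minus_commute)
      then show "Q' \<subseteq> B" by (auto simp: Q'_def B_def)
    qed
    define F where "F = (\<lambda>x. cis (v \<bullet> sgn x))"
    have [measurable]: "F \<in> borel_measurable borel"
    proof -
      have "(\<lambda>x. cis (v \<bullet> x)) \<in> borel_measurable borel"
        by (intro borel_measurable_continuous_onI continuous_intros)
      then show ?thesis unfolding F_def by measurable
    qed
    have [measurable]: "Q \<in> sets borel" "Q' \<in> sets borel" "B \<in> sets borel"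
      by (auto simp: Q_def Q'_def B_def)
    have fin: "emeasure lborel A < \<infinity>" if "A \<subseteq> B" for A
      using that bounded_subset[OF bounded_ball] unfolding B_def by (intro emeasure_bounded_finite) auto
    have nF: "norm (F x) \<le> 1" for x by (simp add: F_def)
    have mQ: "measure lborel Q = \<kappa> * V" "measure lborel Q' = \<kappa> * V"
      by (simp_all add: Q_def Q'_def Q)
    have mD: "measure lborel (B - A) = V - \<kappa> * V" if "A \<subseteq> B" "A \<in> sets borel" "measure lborel A = \<kappa> * V" for A
      using that fin[of B] fin[of A] by (subst measure_Diff) (auto simp: V_def)
    define I where "I A = (\<integral>x. indicator A x *\<^sub>R F x \<partial>lborel)" for A
    have int: "integrable lborel (\<lambda>x. indicator A x *\<^sub>R F x)" if "A \<subseteq> B" "A \<in> sets borel" for A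
      by (rule norm_integral_indicator_le(1)[where C=1]) (use that fin nF in auto)
    have bd: "norm (I A) \<le> measure lborel A" if "A \<subseteq> B" "A \<in> sets borel" for A
      using norm_integral_indicator_le(2)[of F lborel A 1] that fin nF by (auto simp: I_def)
    have split: "I B = I (B - A) + I A" if "A \<subseteq> B" "A \<in> sets borel" for A
    proof -
      have "I (B - A) + I A = (\<integral>x. indicator (B - A) x *\<^sub>R F x + indicator A x *\<^sub>R F x \<partial>lborel)"
        unfolding I_def using int[of A] int[of "B - A"] that by (subst Bochner_Integration.integral_add) auto
      also have "\<dots> = I B" unfolding I_def using that
        by (intro Bochner_Integration.integral_cong) (auto simp: indicator_def)
      finally show ?thesis by simp
    qed
    have shift: "I Q' = (\<integral>x. indicator Q x *\<^sub>R F (x + h *\<^sub>R w) \<partial>lborel)"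
    proof -
      have "I Q' = (\<integral>x. indicator Q' x *\<^sub>R F x \<partial>distr lborel borel ((+) (h *\<^sub>R w)))"
        unfolding I_def lborel_distr_plus ..
      also have "\<dots> = (\<integral>x. indicator Q' (h *\<^sub>R w + x) *\<^sub>R F (h *\<^sub>R w + x) \<partial>lborel)"
        by (subst integral_distr) auto
      also have "\<dots> = (\<integral>x. indicator Q x *\<^sub>R F (x + h *\<^sub>R w) \<partial>lborel)"
        by (intro Bochner_Integration.integral_cong)
           (auto simp: indicator_def Q_def Q'_def dist_norm add.commute algebra_simps)
      finally show ?thesis .
    qed
    define \<delta> where "\<delta> = s * h / 64"
    have \<delta>: "0 \<le> \<delta>" using s h by (simp add: \<delta>_def)
    have "norm (I Q + I Q') \<le> (2 - \<delta>\<^sup>2 / 16) * measure lborel Q"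
    proof -
      have m: "(\<lambda>x. F (x + h *\<^sub>R w)) \<in> borel_measurable lborel" by measurable
      have "integrable lborel (\<lambda>x. indicator Q x *\<^sub>R F (x + h *\<^sub>R w))"
        by (rule norm_integral_indicator_le(1)[where C=1]) (use sub fin nF in auto)
      then have "I Q + I Q' = (\<integral>x. indicator Q x *\<^sub>R (F x + F (x + h *\<^sub>R w)) \<partial>lborel)"
        unfolding shift unfolding I_def scaleR_add_right
        by (intro Bochner_Integration.integral_add[symmetric] int sub) auto
      moreover have "norm (F x + F (x + h *\<^sub>R w)) \<le> 2 - \<delta>\<^sup>2 / 16" if "x \<in> Q" for x
      proof -
        have x: "dist p x < 1/8" using that by (simp add: Q_def)
        note di = direction_increment[OF w(1) p x, of h]
        have "s * (h / 64) \<le> s * (w \<bullet> sgn (x + h *\<^sub>R w) - w \<bullet> sgn x)"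
          "s * (w \<bullet> sgn (x + h *\<^sub>R w) - w \<bullet> sgn x) \<le> s * (4 * h)"
          using di s h by (intro mult_left_mono; simp)+
        then show ?thesis unfolding F_def using \<delta> h
          by (intro norm_cis_add_cis) (auto simp: w(2) \<delta>_def algebra_simps)
      qed
      moreover have "0 \<le> 2 - \<delta>\<^sup>2 / 16"
        using power_mono[of \<delta> 1 2] \<delta> h s by (auto simp: \<delta>_def)
      ultimately show ?thesis using sub fin[of Q]
        by (auto intro!: norm_integral_indicator_le(2))
    qed
    then have IQ: "norm (I Q + I Q') \<le> (2 - \<delta>\<^sup>2 / 16) * (\<kappa> * V)" by (simp add: mQ)
    have "2 *\<^sub>R I B = I (B - Q) + I (B - Q') + (I Q + I Q')"
      using split[of Q] split[of Q'] sub by (simp add: scaleR_2)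
    then have "2 * norm (I B) = norm (I (B - Q) + I (B - Q') + (I Q + I Q'))"
      by (metis abs_numeral norm_scaleR)
    also have "\<dots> \<le> norm (I (B - Q)) + norm (I (B - Q')) + norm (I Q + I Q')"
      by (meson add_mono norm_triangle_le order_refl)
    also have "\<dots> \<le> (V - \<kappa> * V) + (V - \<kappa> * V) + (2 - \<delta>\<^sup>2 / 16) * (\<kappa> * V)"
      using bd[of "B - Q"] bd[of "B - Q'"] mD[of Q] mD[of Q'] sub mQ IQ by (intro add_mono) auto
    also have "\<dots> = 2 * V * (1 - \<kappa> * \<delta>\<^sup>2 / 32)" by (simp add: algebra_simps)
    finally have "norm (I B) / V \<le> 1 - \<kappa> * \<delta>\<^sup>2 / 32" using V by (simp add: field_simps)
    moreover have "c * min 1 (s\<^sup>2) \<le> \<kappa> * \<delta>\<^sup>2 / 32"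
    proof -
      have "min 1 s / 512 \<le> \<delta>" using sh by (simp add: \<delta>_def)
      then have "(min 1 s / 512)\<^sup>2 \<le> \<delta>\<^sup>2" using s by (intro power_mono) auto
      moreover have "(min 1 s)\<^sup>2 = min 1 (s\<^sup>2)"
        using s power_mono[of s 1 2] power_mono[of 1 s 2] by (auto simp: min_def)
      ultimately have "\<kappa> * (min 1 (s\<^sup>2) / 512\<^sup>2) \<le> \<kappa> * \<delta>\<^sup>2" using \<kappa> 
        by (intro mult_left_mono) (auto simp: power_divide)
      then show ?thesis by (simp add: c_def)
    qed
    moreover have "1 - c * min 1 (s\<^sup>2) \<le> exp (- c * min 1 (s\<^sup>2))"
      using exp_ge_add_one_self[of "- c * min 1 (s\<^sup>2)"] by simp
    ultimately have "norm (I B) / V \<le> exp (- c * min 1 (s\<^sup>2))" by linarith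
    moreover have "(\<integral>x. cis (v \<bullet> x) \<partial>uniform_sphere) = I B /\<^sub>R V"
      unfolding I_def F_def V_def B_def
      by (rule integral_uniform_sphere) (intro borel_measurable_continuous_onI continuous_intros)
    ultimately show ?thesis using V by (simp add: s_def divide_inverse_commute)
  qed
  moreover have "c > 0" using \<kappa> by (simp add: c_def)
  ultimately show ?thesis by blast
qed

section \<open>Small ball probabilities for sums with fixed step lengths\<close>

lemma borel_measurable_cis [measurable]: "cis \<in> borel_measurable borel"
  by (intro borel_measurable_continuous_onI continuous_intros)

lemma borel_measurable_vec_nth [measurable]:
  "(\<lambda>x :: real ^ 'n. x $ k) \<in> borel_measurable borel"
  by (intro borel_measurable_continuous_onI continuous_intros)

lemma integral_gaussian_exp_le:
  assumes b: "0 < b"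
  shows "integrable std_normal_distribution (\<lambda>g. exp (- b * g\<^sup>2))"
    "(\<integral>g. exp (- b * g\<^sup>2) \<partial>std_normal_distribution) \<le> 1 / sqrt (2 * b)"
proof -
  interpret real_distribution std_normal_distribution by (rule real_dist_normal_dist)
  show "integrable std_normal_distribution (\<lambda>g. exp (- b * g\<^sup>2))"
    using b by (intro integrable_const_bound[where B=1]) auto
  define \<sigma> where "\<sigma> = 1 / sqrt (2 * b + 1)"
  have \<sigma>: "\<sigma> > 0" "\<sigma>\<^sup>2 = 1 / (2 * b + 1)" using b by (simp_all add: \<sigma>_def power_divide)
  have "std_normal_density g * exp (- b * g\<^sup>2) = \<sigma> * normal_density 0 \<sigma> g" for g
  proof -
    have "sqrt (2 * pi * \<sigma>\<^sup>2) = sqrt (2 * pi) * \<sigma>"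
      using \<sigma>(1) by (simp add: real_sqrt_mult real_sqrt_abs)
    moreover have "exp (- g\<^sup>2 / 2) * exp (- b * g\<^sup>2) = exp (- (g - 0)\<^sup>2 / (2 * \<sigma>\<^sup>2))"
      using b by (simp add: \<sigma>(2) field_simps flip: exp_add)
    ultimately show ?thesis using \<sigma>
      by (simp add: normal_density_def field_simps)
  qed
  then have "(\<integral>g. exp (- b * g\<^sup>2) \<partial>std_normal_distribution) = \<sigma>"
    using \<sigma> by (subst integral_density) auto
  also have "\<sigma> \<le> 1 / sqrt (2 * b)" using b by (simp add: \<sigma>_def frac_le)
  finally show "(\<integral>g. exp (- b * g\<^sup>2) \<partial>std_normal_distribution) \<le> 1 / sqrt (2 * b)" .
qed

lemma gaussian_char_2d:
  "(\<integral>g. cis (fst g * x + snd g * y) \<partial>(std_normal_distribution \<Otimes>\<^sub>M std_normal_distribution)) =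
     complex_of_real (exp (- (x\<^sup>2 + y\<^sup>2) / 2))"
proof -
  interpret N: real_distribution std_normal_distribution by (rule real_dist_normal_dist)
  interpret P: pair_prob_space std_normal_distribution std_normal_distribution ..
  have c: "(\<integral>g. cis (g * z) \<partial>std_normal_distribution) = complex_of_real (exp (- (z\<^sup>2) / 2))" for z
    using fun_cong[OF char_std_normal_distribution, of z] by (simp add: char_def cis_conv_exp mult.commute)
  have i: "integrable (std_normal_distribution \<Otimes>\<^sub>M std_normal_distribution) (\<lambda>g. cis (fst g * x + snd g * y))"
    by (intro P.integrable_const_bound[where B=1]) auto
  have "(\<integral>g. cis (fst g * x + snd g * y) \<partial>(std_normal_distribution \<Otimes>\<^sub>M std_normal_distribution)) =
      (\<integral>g1. \<integral>g2. cis (g1 * x) * cis (g2 * y) \<partial>std_normal_distribution \<partial>std_normal_distribution)"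
    using P.integral_fst'[OF i] by (simp add: cis_mult)
  also have "\<dots> = complex_of_real (exp (- (x\<^sup>2) / 2)) * complex_of_real (exp (- (y\<^sup>2) / 2))"
    by (simp add: c)
  also have "\<dots> = complex_of_real (exp (- (x\<^sup>2 + y\<^sup>2) / 2))"
    by (simp add: add_divide_distrib flip: of_real_mult exp_add)
  finally show ?thesis .
qed

text \<open>
  A form of Esseen's concentration inequality. Two coordinates suffice: the Gaussian average of
  \<open>exp (- b \<parallel>v\<parallel>\<^sup>2)\<close> over the plane that they span decays like \<open>1 / b\<close>, and using further coordinates
  would only improve this rate.
\<close>

lemma (in prob_space) small_ball_of_char_bound:
  fixes Z :: "'a \<Rightarrow> real ^ 'n" and i j :: 'n
  assumes [measurable]: "random_variable borel Z" and ij: "i \<noteq> j" and b: "0 < b"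
    and char: "\<And>v. norm (\<integral>\<omega>. cis (v \<bullet> Z \<omega>) \<partial>M) \<le> A + exp (- b * (norm v)\<^sup>2)"
  shows "prob {\<omega> \<in> space M. norm (Z \<omega>) \<le> R} \<le> exp (R\<^sup>2 / 2) * (A + 1 / (2 * b))"
proof -
  define N2 where "N2 = std_normal_distribution \<Otimes>\<^sub>M std_normal_distribution"
  interpret N: real_distribution std_normal_distribution by (rule real_dist_normal_dist)
  interpret P: pair_prob_space std_normal_distribution std_normal_distribution ..
  interpret N2: prob_space N2 unfolding N2_def by unfold_locales
  interpret Q: pair_prob_space M N2 ..
  define v where "v g = fst g *\<^sub>R axis i 1 + snd g *\<^sub>R axis j (1::real)" for g :: "real \<times> real"
  have v: "v g \<bullet> z = fst g * z $ i + snd g * z $ j" for g z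
    by (simp add: v_def inner_add_left inner_axis' )
  have nv: "(norm (v g))\<^sup>2 = (fst g)\<^sup>2 + (snd g)\<^sup>2" for g
    unfolding power2_norm_eq_inner v using ij by (simp add: v_def axis_def power2_eq_square)
  have [measurable]: "(\<lambda>\<omega>. Z \<omega> $ k) \<in> borel_measurable M" for k
    by measurable
  have [simp]: "sets N2 = sets (borel \<Otimes>\<^sub>M borel)" unfolding N2_def by (intro sets_pair_measure_cong) auto
  have [measurable]: "fst \<in> borel_measurable N2" "snd \<in> borel_measurable N2"
    unfolding N2_def by measurable
  define E where "E = (\<integral>\<omega>. exp (- ((Z \<omega> $ i)\<^sup>2 + (Z \<omega> $ j)\<^sup>2) / 2) \<partial>M)"
  have "complex_of_real E = (\<integral>\<omega>. \<integral>g. cis (v g \<bullet> Z \<omega>) \<partial>N2 \<partial>M)"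
    unfolding E_def v N2_def gaussian_char_2d by simp
  also have "\<dots> = (\<integral>g. \<integral>\<omega>. cis (v g \<bullet> Z \<omega>) \<partial>M \<partial>N2)"
  proof (rule Q.Fubini_integral[symmetric], rule Q.integrable_const_bound[where B=1])
    have "(\<lambda>p. cis (fst (snd p) * Z (fst p) $ i + snd (snd p) * Z (fst p) $ j)) \<in> borel_measurable (M \<Otimes>\<^sub>M N2)"
      by measurable
    then show "(\<lambda>(\<omega>, g). cis (v g \<bullet> Z \<omega>)) \<in> borel_measurable (M \<Otimes>\<^sub>M N2)"
      by (simp add: v case_prod_unfold)
  qed auto
  finally have E: "complex_of_real E = (\<integral>g. \<integral>\<omega>. cis (v g \<bullet> Z \<omega>) \<partial>M \<partial>N2)" .
  let ?h = "\<lambda>g. A + exp (- b * (fst g)\<^sup>2) * exp (- b * (snd g)\<^sup>2)"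
  have ih: "integrable N2 (\<lambda>g. exp (- b * (fst g)\<^sup>2) * exp (- b * (snd g)\<^sup>2))"
    using b by (intro N2.integrable_const_bound[where B=1]) (auto simp: mult_le_one)
  have ch: "norm (\<integral>\<omega>. cis (v g \<bullet> Z \<omega>) \<partial>M) \<le> ?h g" for g
    using char[of "v g"] by (simp add: nv distrib_left exp_add[symmetric] del: exp_add)
  have "norm (complex_of_real E) \<le> (\<integral>g. ?h g \<partial>N2)"
    unfolding E
  proof (rule order_trans[OF integral_norm_bound], cases "integrable N2 (\<lambda>g. norm (\<integral>\<omega>. cis (v g \<bullet> Z \<omega>) \<partial>M))")
    case True
    then show "(\<integral>g. norm (\<integral>\<omega>. cis (v g \<bullet> Z \<omega>) \<partial>M) \<partial>N2) \<le> (\<integral>g. ?h g \<partial>N2)"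
      by (intro integral_mono) (use ih ch in auto)
  next
    case False
    have "0 \<le> ?h g" for g using ch[of g] norm_ge_zero order_trans by blast
    then have "0 \<le> (\<integral>g. ?h g \<partial>N2)" by (intro integral_nonneg_AE) auto
    with False show "(\<integral>g. norm (\<integral>\<omega>. cis (v g \<bullet> Z \<omega>) \<partial>M) \<partial>N2) \<le> (\<integral>g. ?h g \<partial>N2)"
      by (simp add: not_integrable_integral_eq)
  qed
  also have "\<dots> = A + (\<integral>g. exp (- b * (fst g)\<^sup>2) * exp (- b * (snd g)\<^sup>2) \<partial>N2)"
    using ih by (subst Bochner_Integration.integral_add) (auto simp: N2.prob_space)
  also have "(\<integral>g. exp (- b * (fst g)\<^sup>2) * exp (- b * (snd g)\<^sup>2) \<partial>N2) =
      (\<integral>g. exp (- b * g\<^sup>2) \<partial>std_normal_distribution) * (\<integral>g. exp (- b * g\<^sup>2) \<partial>std_normal_distribution)"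
    using P.integral_fst'[OF ih[unfolded N2_def]] unfolding N2_def by simp
  also have "\<dots> \<le> (1 / sqrt (2 * b)) * (1 / sqrt (2 * b))"
    using b integral_gaussian_exp_le(2)[OF b] by (intro mult_mono integral_nonneg_AE) auto
  also have "\<dots> = 1 / (2 * b)" using b by simp
  finally have E': "E \<le> A + 1 / (2 * b)" by simp
  have "prob {\<omega> \<in> space M. norm (Z \<omega>) \<le> R} = (\<integral>\<omega>. indicator {\<omega> \<in> space M. norm (Z \<omega>) \<le> R} \<omega> \<partial>M)"
    by simp
  also have "\<dots> \<le> (\<integral>\<omega>. exp (R\<^sup>2 / 2) * exp (- ((Z \<omega> $ i)\<^sup>2 + (Z \<omega> $ j)\<^sup>2) / 2) \<partial>M)"
  proof (rule integral_mono)
    show "integrable M (\<lambda>\<omega>. exp (R\<^sup>2 / 2) * exp (- ((Z \<omega> $ i)\<^sup>2 + (Z \<omega> $ j)\<^sup>2) / 2))"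
      by (intro integrable_mult_right integrable_const_bound[where B=1]) auto
    fix \<omega>
    have "(Z \<omega> $ i)\<^sup>2 + (Z \<omega> $ j)\<^sup>2 \<le> R\<^sup>2" if "norm (Z \<omega>) \<le> R"
    proof -
      have "(Z \<omega> $ i)\<^sup>2 + (Z \<omega> $ j)\<^sup>2 = (\<Sum>k\<in>{i,j}. (Z \<omega> $ k)\<^sup>2)" using ij by simp
      also have "\<dots> \<le> (\<Sum>k\<in>UNIV. (Z \<omega> $ k)\<^sup>2)" by (intro sum_mono2) auto
      also have "\<dots> = (norm (Z \<omega>))\<^sup>2" by (simp add: norm_vec_def L2_set_def sum_nonneg)
      also have "\<dots> \<le> R\<^sup>2" using that by (intro power_mono) auto
      finally show ?thesis .
    qed
    then show "indicator {\<omega> \<in> space M. norm (Z \<omega>) \<le> R} \<omega> \<le> exp (R\<^sup>2 / 2) * exp (- ((Z \<omega> $ i)\<^sup>2 + (Z \<omega> $ j)\<^sup>2) / 2)"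
      by (auto simp: indicator_def field_simps simp flip: exp_add)
  qed (intro integrable_real_indicator, auto simp: less_top[symmetric])
  also have "\<dots> = exp (R\<^sup>2 / 2) * E" by (simp add: E_def)
  also have "\<dots> \<le> exp (R\<^sup>2 / 2) * (A + 1 / (2 * b))" using E' by simp
  finally show ?thesis .
qed

text \<open>
  The characteristic function of the sum is the product of those of the steps. Only the long steps are
  kept; each contributes a factor \<open>exp (- c min(1, a\<^sup>2 \<parallel>v\<parallel>\<^sup>2))\<close>. The minimum is then split into the sum of
  two exponentials, a constant and a Gaussian in \<open>v\<close>.
\<close>

lemma (in prob_space) char_fixed_steps_le:
  fixes f :: "'i \<Rightarrow> 'a \<Rightarrow> real ^ 'n" and \<xi> :: "'i \<Rightarrow> real" and n :: real
  assumes indep: "indep_vars (\<lambda>_. borel) f S" and unif: "\<And>k. k \<in> S \<Longrightarrow> distr M borel (f k) = uniform_sphere"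
    and c: "0 < c" "\<And>v :: real ^ 'n. norm (\<integral>x. cis (v \<bullet> x) \<partial>uniform_sphere) \<le> exp (- c * min 1 ((norm v)\<^sup>2))"
    and S: "finite S" and a: "0 < a" and n: "n \<le> card {k \<in> S. a \<le> \<xi> k}"
  shows "norm (\<integral>\<omega>. cis (v \<bullet> (\<Sum>k\<in>S. \<xi> k *\<^sub>R f k \<omega>)) \<partial>M)
          \<le> exp (- c * n) + exp (- (c * n * a\<^sup>2) * (norm v)\<^sup>2)"
proof -
  let ?K = "{k \<in> S. a \<le> \<xi> k}"
  have rv: "random_variable borel (f k)" if "k \<in> S" for k using indep that by (auto simp: indep_vars_def)
  have iX: "indep_vars (\<lambda>_. borel) (\<lambda>k \<omega>. cis ((\<xi> k *\<^sub>R v) \<bullet> f k \<omega>)) S"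
    by (rule indep_vars_compose2[OF indep, where Y="\<lambda>k x. cis ((\<xi> k *\<^sub>R v) \<bullet> x)"]) simp
  have cis_sum: "cis (v \<bullet> (\<Sum>k\<in>S. \<xi> k *\<^sub>R f k \<omega>)) = (\<Prod>k\<in>S. cis ((\<xi> k *\<^sub>R v) \<bullet> f k \<omega>))" for \<omega>
    using S by (induction S rule: finite_induct) (simp_all add: inner_add_right flip: cis_mult)
  have "(\<integral>\<omega>. cis (v \<bullet> (\<Sum>k\<in>S. \<xi> k *\<^sub>R f k \<omega>)) \<partial>M) = (\<Prod>k\<in>S. \<integral>\<omega>. cis ((\<xi> k *\<^sub>R v) \<bullet> f k \<omega>) \<partial>M)"
    unfolding cis_sum
    by (rule indep_vars_lebesgue_integral[OF S iX]) (use rv in \<open>auto intro!: integrable_const_bound[where B=1]\<close>)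
  also have "\<dots> = (\<Prod>k\<in>S. \<integral>x. cis ((\<xi> k *\<^sub>R v) \<bullet> x) \<partial>uniform_sphere)"
    by (intro prod.cong refl, subst unif[symmetric], assumption, subst integral_distr) (use rv in auto)
  finally have "norm (\<integral>\<omega>. cis (v \<bullet> (\<Sum>k\<in>S. \<xi> k *\<^sub>R f k \<omega>)) \<partial>M) =
      (\<Prod>k\<in>S. norm (\<integral>x. cis ((\<xi> k *\<^sub>R v) \<bullet> x) \<partial>uniform_sphere))" by (simp only: prod_norm)
  also have "\<dots> \<le> (\<Prod>k\<in>S. if k \<in> ?K then exp (- c * min 1 (a\<^sup>2 * (norm v)\<^sup>2)) else 1)"
  proof (intro prod_mono conjI norm_ge_zero)
    fix k assume k: "k \<in> S"
    have "norm (\<integral>x. cis ((\<xi> k *\<^sub>R v) \<bullet> x) \<partial>uniform_sphere) \<le> exp (- c * min 1 ((norm (\<xi> k *\<^sub>R v))\<^sup>2))"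
      by (rule c(2))
    also have "\<dots> \<le> (if k \<in> ?K then exp (- c * min 1 (a\<^sup>2 * (norm v)\<^sup>2)) else 1)"
    proof (cases "k \<in> ?K")
      case True
      then have "a\<^sup>2 * (norm v)\<^sup>2 \<le> (norm (\<xi> k *\<^sub>R v))\<^sup>2"
        using a by (auto simp: power_mult_distrib intro!: mult_right_mono power_mono)
      then have "c * min 1 (a\<^sup>2 * (norm v)\<^sup>2) \<le> c * min 1 ((norm (\<xi> k *\<^sub>R v))\<^sup>2)"
        using c(1) by (intro mult_left_mono) auto
      with True show ?thesis by simp
    next
      case False with c(1) show ?thesis by auto
    qed
    finally show "norm (\<integral>x. cis ((\<xi> k *\<^sub>R v) \<bullet> x) \<partial>uniform_sphere) \<le> (if k \<in> ?K then exp (- c * min 1 (a\<^sup>2 * (norm v)\<^sup>2)) else 1)" .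
  qed
  also have "\<dots> = (\<Prod>k\<in>?K. exp (- c * min 1 (a\<^sup>2 * (norm v)\<^sup>2)))"
    using S Int_absorb1[of ?K S] by (subst prod.If_cases) auto
  also have "\<dots> = exp (- (card ?K * (c * min 1 (a\<^sup>2 * (norm v)\<^sup>2))))"
    by (simp flip: exp_of_nat_mult)
  also have "\<dots> \<le> exp (- (n * (c * min 1 (a\<^sup>2 * (norm v)\<^sup>2))))"
    using n c(1) by (auto intro!: mult_right_mono)
  also have "\<dots> \<le> exp (- c * n) + exp (- (c * n * a\<^sup>2) * (norm v)\<^sup>2)"
    by (auto simp: min_def mult_ac)
  finally show ?thesis .
qed

lemma (in prob_space) small_ball_fixed_steps:
  fixes f :: "'i \<Rightarrow> 'a \<Rightarrow> real ^ 'n" and \<xi> :: "'i \<Rightarrow> real" and n :: real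
  assumes dim: "CARD('n) \<ge> 2"
    and indep: "indep_vars (\<lambda>_. borel) f S" and unif: "\<And>k. k \<in> S \<Longrightarrow> distr M borel (f k) = uniform_sphere"
    and c: "0 < c" "\<And>v :: real ^ 'n. norm (\<integral>x. cis (v \<bullet> x) \<partial>uniform_sphere) \<le> exp (- c * min 1 ((norm v)\<^sup>2))"
    and S: "finite S" and a: "0 < a" and n: "0 < n" "n \<le> card {k \<in> S. a \<le> \<xi> k}"
  shows "prob {\<omega> \<in> space M. norm (\<Sum>k\<in>S. \<xi> k *\<^sub>R f k \<omega>) \<le> R}
          \<le> exp (R\<^sup>2 / 2) * (exp (- c * n) + 1 / (2 * (c * n * a\<^sup>2)))"
proof -
  obtain i j :: 'n where ij: "i \<noteq> j"
    using dim by (metis card_2_iff' card_le_Suc0_iff_eq finite not_less_eq_eq numeral_2_eq_2 UNIV_I)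
  have [measurable]: "random_variable borel (f k)" if "k \<in> S" for k
    using indep that by (auto simp: indep_vars_def)
  show ?thesis
  proof (rule small_ball_of_char_bound[OF _ ij])
    show "random_variable borel (\<lambda>\<omega>. \<Sum>k\<in>S. \<xi> k *\<^sub>R f k \<omega>)" by measurable
    show "norm (\<integral>\<omega>. cis (v \<bullet> (\<Sum>k\<in>S. \<xi> k *\<^sub>R f k \<omega>)) \<partial>M)
        \<le> exp (- c * n) + exp (- (c * n * a\<^sup>2) * (norm v)\<^sup>2)" for v
      by (rule char_fixed_steps_le[OF indep unif c S a n(2)])
  qed (use c n a in simp)
qed

section \<open>Conditioning on an independent random element\<close>

text \<open>
  Independence makes the joint law a product measure, so by Fubini a bound that holds for each frozen
  value of \<open>Y\<close> holds without freezing. The two random elements take values in different types, which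
  is why independence enters through the generated \<open>\<sigma>\<close>-algebras.
\<close>

lemma (in prob_space) prob_le_of_indep_section:
  assumes X: "X \<in> space M \<rightarrow> space N1" and Y: "Y \<in> space M \<rightarrow> space N2"
    and indep: "indep_set (sets (vimage_algebra (space M) X N1)) (sets (vimage_algebra (space M) Y N2))"
    and E: "E \<in> sets (N1 \<Otimes>\<^sub>M N2)"
    and b: "\<And>y. y \<in> space N2 \<Longrightarrow> prob {\<omega> \<in> space M. (X \<omega>, y) \<in> E} \<le> b"
  shows "prob {\<omega> \<in> space M. (X \<omega>, Y \<omega>) \<in> E} \<le> b"
proof -
  have ev: "X -` A \<inter> space M \<in> events" if "A \<in> sets N1" for A
    using indep_setD_ev1[OF indep] in_vimage_algebra[OF that, of X "space M"] by auto
  have ev2: "Y -` A \<inter> space M \<in> events" if "A \<in> sets N2" for A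
    using indep_setD_ev2[OF indep] in_vimage_algebra[OF that, of Y "space M"] by auto
  have mX [measurable]: "X \<in> measurable M N1" using X ev by (intro measurableI) auto
  have mY [measurable]: "Y \<in> measurable M N2" using Y ev2 by (intro measurableI) auto
  interpret PX: prob_space "distr M N1 X" by (rule prob_space_distr) measurable
  interpret PY: prob_space "distr M N2 Y" by (rule prob_space_distr) measurable
  interpret P: pair_prob_space "distr M N1 X" "distr M N2 Y" ..
  have eq: "distr M N1 X \<Otimes>\<^sub>M distr M N2 Y = distr M (N1 \<Otimes>\<^sub>M N2) (\<lambda>\<omega>. (X \<omega>, Y \<omega>))"
  proof (rule pair_measure_eqI)
    show "sets (distr M N1 X \<Otimes>\<^sub>M distr M N2 Y) = sets (distr M (N1 \<Otimes>\<^sub>M N2) (\<lambda>\<omega>. (X \<omega>, Y \<omega>)))"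
      by (simp cong: sets_pair_measure_cong)
    fix A B assume "A \<in> sets (distr M N1 X)" "B \<in> sets (distr M N2 Y)"
    then have [measurable]: "A \<in> sets N1" "B \<in> sets N2" by auto
    have "prob ((X -` A \<inter> space M) \<inter> (Y -` B \<inter> space M)) = prob (X -` A \<inter> space M) * prob (Y -` B \<inter> space M)"
      by (rule indep_setD[OF indep]) (auto intro: in_vimage_algebra)
    moreover have "(\<lambda>\<omega>. (X \<omega>, Y \<omega>)) -` (A \<times> B) \<inter> space M = (X -` A \<inter> space M) \<inter> (Y -` B \<inter> space M)" by auto
    ultimately show "emeasure (distr M N1 X) A * emeasure (distr M N2 Y) B =
        emeasure (distr M (N1 \<Otimes>\<^sub>M N2) (\<lambda>\<omega>. (X \<omega>, Y \<omega>))) (A \<times> B)"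
      by (simp add: emeasure_distr emeasure_eq_measure ennreal_mult)
  qed (unfold_locales)
  have "emeasure M {\<omega> \<in> space M. (X \<omega>, Y \<omega>) \<in> E} = emeasure (distr M N1 X \<Otimes>\<^sub>M distr M N2 Y) E"
    unfolding eq using E by (subst emeasure_distr) (auto intro!: arg_cong[where f="emeasure M"])
  also have "\<dots> = (\<integral>\<^sup>+ y. emeasure (distr M N1 X) ((\<lambda>x. (x, y)) -` E) \<partial>distr M N2 Y)"
    using E by (intro P.emeasure_pair_measure_alt2) (simp cong: sets_pair_measure_cong)
  also have "\<dots> \<le> (\<integral>\<^sup>+ y. ennreal b \<partial>distr M N2 Y)"
  proof (rule nn_integral_mono)
    fix y assume "y \<in> space (distr M N2 Y)"
    then have y: "y \<in> space N2" by simp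
    have "(\<lambda>x. (x, y)) -` E \<in> sets N1" using E by (rule sets_Pair2)
    then have "emeasure (distr M N1 X) ((\<lambda>x. (x, y)) -` E) = emeasure M {\<omega> \<in> space M. (X \<omega>, y) \<in> E}"
      by (subst emeasure_distr) (auto intro!: arg_cong[where f="emeasure M"])
    also have "\<dots> \<le> ennreal b" using b[OF y] by (simp add: emeasure_eq_measure ennreal_leI)
    finally show "emeasure (distr M N1 X) ((\<lambda>x. (x, y)) -` E) \<le> ennreal b" .
  qed
  also have "\<dots> = ennreal b" using PY.emeasure_space_1 by simp
  finally have le: "ennreal (prob {\<omega> \<in> space M. (X \<omega>, Y \<omega>) \<in> E}) \<le> ennreal b"
    by (simp add: emeasure_eq_measure)
  have "0 \<le> b"
  proof -
    obtain \<omega> where "\<omega> \<in> space M" using not_empty by auto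
    then have "Y \<omega> \<in> space N2" using Y by auto
    from b[OF this] show ?thesis using measure_nonneg order_trans by blast
  qed
  with le show ?thesis by (simp add: ennreal_le_iff)
qed

section \<open>Many long gaps between the points of the process\<close>

definition block :: "real \<Rightarrow> real \<Rightarrow> nat \<Rightarrow> real set" where
  "block s h i = {s + real i * h ..< s + real (Suc i) * h}"

lemma disjoint_family_block: "0 \<le> h \<Longrightarrow> disjoint_family (block s h)"
  unfolding disjoint_family_on_def
proof (intro ballI impI)
  fix i j :: nat assume h: "0 \<le> h" and "i \<noteq> j"
  have *: "block s h i \<inter> block s h j = {}" if "i < j" for i j
  proof -
    have "real (Suc i) * h \<le> real j * h" using that h by (intro mult_right_mono) auto
    then show ?thesis by (auto simp: block_def)
  qed
  show "block s h i \<inter> block s h j = {}" using *[of i j] *[of j i] \<open>i \<noteq> j\<close> by (cases "i < j") auto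
qed

lemma block_properties:
  assumes "0 \<le> s" "0 \<le> h"
  shows "block s h i \<in> sets borel" "bounded (block s h i)" "block s h i \<subseteq> {0..}"
proof -
  have "0 \<le> s + real i * h" using assms by simp
  then show "block s h i \<subseteq> {0..}" by (auto simp only: block_def atLeastLessThan_iff atLeast_iff)
qed (simp_all add: block_def)

text \<open>
  The gap between consecutive points that starts at the last point of block \<open>2 j\<close> covers the whole of
  block \<open>2 j + 1\<close>.
\<close>

definition gap_start :: "(nat \<Rightarrow> 'w \<Rightarrow> real) \<Rightarrow> real \<Rightarrow> real \<Rightarrow> nat \<Rightarrow> 'w \<Rightarrow> bool" where
  "gap_start \<tau> s h j \<omega> \<longleftrightarrow>
     1 \<le> point_count \<tau> (block s h (2 * j)) \<omega> \<and> point_count \<tau> (block s h (2 * j + 1)) \<omega> = 0"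

context poisson_point_process begin

lemma indep_block_counts:
  assumes "0 \<le> s" "0 \<le> h"
  shows "indep_vars (\<lambda>_. count_space UNIV) (\<lambda>i. point_count \<tau> (block s h i)) UNIV"
  by (rule count_indep) (use assms block_properties disjoint_family_block in auto)

lemma prob_gap_start_ge:
  assumes s: "0 \<le> s" "0 \<le> h"
    and b1: "b1 \<le> (LINT t:block s h (2 * j)|lborel. r t)"
    and b2: "(LINT t:block s h (2 * j + 1)|lborel. r t) \<le> b2"
  shows "{\<omega> \<in> space M. gap_start \<tau> s h j \<omega>} \<in> events"
    "(1 - exp (- b1)) * exp (- b2) \<le> prob {\<omega> \<in> space M. gap_start \<tau> s h j \<omega>}"
proof -
  note ind = indep_block_counts[OF s]
  have bl: "block s h i \<in> sets borel" "bounded (block s h i)" "block s h i \<subseteq> {0..}" for i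
    using block_properties[OF s] by auto
  let ?N = "\<lambda>i. point_count \<tau> (block s h i)"
  have [measurable]: "random_variable (count_space UNIV) (?N i)" for i using ind by (auto simp: indep_vars_def)
  show "{\<omega> \<in> space M. gap_start \<tau> s h j \<omega>} \<in> events" unfolding gap_start_def by measurable
  define B where "B i = (if i = 2 * j then {1..} else {0::nat})" for i
  have "prob (\<Inter>i\<in>{2*j, 2*j+1}. ?N i -` B i \<inter> space M) = (\<Prod>i\<in>{2*j, 2*j+1}. prob (?N i -` B i \<inter> space M))"
    by (rule indep_varsD[OF ind]) auto
  moreover have "(\<Inter>i\<in>{2*j, 2*j+1}. ?N i -` B i \<inter> space M) = {\<omega> \<in> space M. gap_start \<tau> s h j \<omega>}"
    by (auto simp: B_def gap_start_def)
  moreover have "prob (?N (2*j+1) -` B (2*j+1) \<inter> space M) = exp (- (LINT t:block s h (2*j+1)|lborel. r t))"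
  proof -
    have "?N (2*j+1) -` B (2*j+1) \<inter> space M = {\<omega> \<in> space M. ?N (2*j+1) \<omega> = 0}" by (auto simp: B_def)
    then show ?thesis using count_poisson[OF bl, of "2*j+1" 0] by simp
  qed
  moreover have "prob (?N (2*j) -` B (2*j) \<inter> space M) = 1 - exp (- (LINT t:block s h (2*j)|lborel. r t))"
  proof -
    have "?N (2*j) -` B (2*j) \<inter> space M = space M - {\<omega> \<in> space M. ?N (2*j) \<omega> = 0}" by (auto simp: B_def)
    then show ?thesis using count_poisson[OF bl, of "2*j" 0] by (simp add: prob_compl)
  qed
  ultimately have eq: "prob {\<omega> \<in> space M. gap_start \<tau> s h j \<omega>} =
     (1 - exp (- (LINT t:block s h (2*j)|lborel. r t))) * exp (- (LINT t:block s h (2*j+1)|lborel. r t))"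
    by simp
  have "0 \<le> prob (?N (2*j) -` B (2*j) \<inter> space M)" by simp
  with \<open>prob (?N (2*j) -` B (2*j) \<inter> space M) = _\<close>
  have "0 \<le> 1 - exp (- (LINT t:block s h (2*j)|lborel. r t))" by simp
  then show "(1 - exp (- b1)) * exp (- b2) \<le> prob {\<omega> \<in> space M. gap_start \<tau> s h j \<omega>}"
    unfolding eq using b1 b2 by (intro mult_mono) auto
qed

text \<open>
  A Chernoff bound. The pairs of blocks are independent, so \<open>exp (- K)\<close>, where \<open>K\<close> is the number of gap
  starts, has expectation at most \<open>(1 - \<kappa>)\<^sup>m \<le> exp (- \<kappa> m)\<close>. Markov's inequality at level \<open>\<kappa> m / 2\<close> loses
  half of the exponent. The factor \<open>1 - exp (- 1)\<close> in \<open>\<kappa>\<close> is the loss in \<open>exp (- K)\<close> caused by one gap start.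
\<close>

lemma prob_few_gap_starts_le:
  assumes s: "0 \<le> s" "0 \<le> h"
    and b1: "\<And>j. j < m \<Longrightarrow> b1 \<le> (LINT t:block s h (2 * j)|lborel. r t)"
    and b2: "\<And>j. j < m \<Longrightarrow> (LINT t:block s h (2 * j + 1)|lborel. r t) \<le> b2"
    and \<kappa>: "\<kappa> = (1 - exp (- 1)) * ((1 - exp (- b1)) * exp (- b2))"
  shows "{\<omega> \<in> space M. real (card {j. j < m \<and> gap_start \<tau> s h j \<omega>}) \<le> \<kappa> / 2 * m} \<in> events"
    "prob {\<omega> \<in> space M. real (card {j. j < m \<and> gap_start \<tau> s h j \<omega>}) \<le> \<kappa> / 2 * m} \<le> exp (- (\<kappa> / 2) * m)"
proof -
  note ind = indep_block_counts[OF s]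
  let ?N = "\<lambda>i. point_count \<tau> (block s h i)"
  have [measurable]: "random_variable (count_space UNIV) (?N i)" for i using ind by (auto simp: indep_vars_def)
  define e where "e = exp (- 1 :: real)"
  have e: "0 < e" "e < 1" by (auto simp: e_def)
  define X where "X j \<omega> = (if gap_start \<tau> s h j \<omega> then e else 1)" for j \<omega>
  have mX [measurable]: "X j \<in> borel_measurable M" for j unfolding X_def gap_start_def by measurable
  have iX: "indep_vars (\<lambda>_. borel) X {..<m}"
  proof -
    define K where "K j = {2 * j, 2 * j + 1}" for j :: nat
    have "disjoint_family_on K {..<m}" 
      unfolding disjoint_family_on_def
    proof (intro ballI impI)
      fix i j :: nat assume "i \<noteq> j"
      moreover have "2 * i \<noteq> 2 * j + 1" "2 * j \<noteq> 2 * i + 1" by presburger+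
      ultimately show "K i \<inter> K j = {}" by (auto simp: K_def)
    qed
    then have "indep_vars (\<lambda>j. PiM (K j) (\<lambda>_. count_space UNIV)) (\<lambda>j \<omega>. restrict (\<lambda>i. ?N i \<omega>) (K j)) {..<m}"
      by (intro indep_vars_restrict[OF ind]) auto
    moreover have "(\<lambda>g. if 1 \<le> g (2 * j) \<and> g (2 * j + 1) = 0 then e else 1)
        \<in> borel_measurable (PiM (K j) (\<lambda>_. count_space (UNIV :: nat set)))" for j
    proof -
      have [measurable]: "(\<lambda>g. g (2 * j)) \<in> PiM (K j) (\<lambda>_. count_space (UNIV :: nat set)) \<rightarrow>\<^sub>M count_space UNIV"
        "(\<lambda>g. g (2 * j + 1)) \<in> PiM (K j) (\<lambda>_. count_space (UNIV :: nat set)) \<rightarrow>\<^sub>M count_space UNIV"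
        by (auto simp: K_def intro!: measurable_component_singleton)
      show ?thesis by measurable
    qed
    ultimately have "indep_vars (\<lambda>_. borel) (\<lambda>j \<omega>. (\<lambda>g. if 1 \<le> g (2 * j) \<and> g (2 * j + 1) = 0 then e else 1)
        (restrict (\<lambda>i. ?N i \<omega>) (K j))) {..<m}"
      by (rule indep_vars_compose2)
    then show ?thesis by (simp add: X_def[abs_def] gap_start_def K_def)
  qed
  have bX: "0 \<le> X j \<omega>" "X j \<omega> \<le> 1" for j \<omega> using e by (auto simp: X_def)
  have intX: "integrable M (X j)" for j
    by (intro integrable_const_bound[where B=1]) (use bX in auto)
  have EX: "(\<integral>\<omega>. X j \<omega> \<partial>M) \<le> exp (- \<kappa>)" if "j < m" for j
  proof -
    note g = prob_gap_start_ge[OF s b1[OF that] b2[OF that]]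
    have gi: "integrable M (indicator {\<omega> \<in> space M. gap_start \<tau> s h j \<omega>} :: _ \<Rightarrow> real)"
      using g(1) by (intro integrable_real_indicator) (auto simp: emeasure_eq_measure)
    have "X j \<omega> = 1 - (1 - e) * indicator {\<omega> \<in> space M. gap_start \<tau> s h j \<omega>} \<omega>" if "\<omega> \<in> space M" for \<omega>
      using that by (auto simp: X_def)
    then have "(\<integral>\<omega>. X j \<omega> \<partial>M) = (\<integral>\<omega>. 1 - (1 - e) * indicator {\<omega> \<in> space M. gap_start \<tau> s h j \<omega>} \<omega> \<partial>M)"
      by (intro Bochner_Integration.integral_cong) auto
    also have "\<dots> = 1 - (1 - e) * prob {\<omega> \<in> space M. gap_start \<tau> s h j \<omega>}"
      using g(1) gi by (subst Bochner_Integration.integral_diff) (simp_all add: prob_space)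
    also have "\<dots> \<le> 1 - \<kappa>" using g(2) e unfolding \<kappa> e_def[symmetric] by (intro diff_left_mono mult_left_mono) auto
    also have "\<dots> \<le> exp (- \<kappa>)" using exp_ge_add_one_self[of "- \<kappa>"] by simp
    finally show ?thesis .
  qed
  have "(\<integral>\<omega>. (\<Prod>j<m. X j \<omega>) \<partial>M) = (\<Prod>j<m. \<integral>\<omega>. X j \<omega> \<partial>M)"
    by (rule indep_vars_lebesgue_integral) (use iX intX in auto)
  also have "\<dots> \<le> (\<Prod>j<m. exp (- \<kappa>))"
    by (intro prod_mono conjI Bochner_Integration.integral_nonneg) (use bX EX in auto)
  also have "\<dots> = exp (- \<kappa> * m)" using exp_of_nat_mult[of m "- \<kappa>"] by (simp add: mult.commute)
  finally have EP: "(\<integral>\<omega>. (\<Prod>j<m. X j \<omega>) \<partial>M) \<le> exp (- \<kappa> * m)" .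
  let ?c = "\<lambda>\<omega>. card {j. j < m \<and> gap_start \<tau> s h j \<omega>}"
  have PX: "(\<Prod>j<m. X j \<omega>) = exp (- real (?c \<omega>))" for \<omega>
  proof -
    have "(\<Prod>j<m. X j \<omega>) = e ^ card ({..<m} \<inter> {j. gap_start \<tau> s h j \<omega>})"
      unfolding X_def by (subst prod.If_cases) auto
    also have "{..<m} \<inter> {j. gap_start \<tau> s h j \<omega>} = {j. j < m \<and> gap_start \<tau> s h j \<omega>}" by auto
    finally show ?thesis using exp_of_nat_mult[of "?c \<omega>" "- 1 :: real"] by (simp add: e_def)
  qed
  let ?A = "{\<omega> \<in> space M. real (?c \<omega>) \<le> \<kappa> / 2 * m}"
  have Aeq: "?A = {\<omega> \<in> space M. exp (- (\<kappa> / 2 * m)) \<le> (\<Prod>j<m. X j \<omega>)}"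
    by (simp only: PX exp_le_cancel_iff neg_le_iff_le)
  have "(\<lambda>\<omega>. \<Prod>j<m. X j \<omega>) \<in> borel_measurable M" by (intro borel_measurable_prod mX)
  then show A: "?A \<in> events" unfolding Aeq by (intro borel_measurable_le) auto
  have "integrable M (\<lambda>\<omega>. \<Prod>j<m. X j \<omega>)"
    by (rule indep_vars_integrable) (use iX intX in auto)
  then have "prob ?A \<le> (\<integral>\<omega>. (\<Prod>j<m. X j \<omega>) \<partial>M) / exp (- (\<kappa> / 2 * m))"
    unfolding Aeq
    by (rule integral_Markov_inequality_measure[where A="{}"]) (auto intro!: prod_nonneg bX)
  also have "\<dots> \<le> exp (- \<kappa> * m) / exp (- (\<kappa> / 2 * m))"
    by (rule divide_right_mono[OF EP exp_ge_zero])
  also have "\<dots> = exp (- \<kappa> * m - - (\<kappa> / 2 * m))" by (rule exp_diff[symmetric])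
  also have "- \<kappa> * m - - (\<kappa> / 2 * m) = - (\<kappa> / 2) * m" by (simp add: algebra_simps)
  finally show "prob ?A \<le> exp (- (\<kappa> / 2) * m)" .
qed

end

text \<open>
  Assign to each gap start the index of the last point in its first block. This assignment is injective
  because the blocks are disjoint, and the gap after that point is at least \<open>h\<close> long, even when cut off
  at time \<open>t\<close>, because its second block ends no later than \<open>t\<close>.
\<close>

lemma card_gap_starts_le:
  fixes y :: "nat \<Rightarrow> real"
  assumes mono: "mono y" and L: "t < y L" and h: "0 < h" and t: "s + real (2 * m) * h \<le> t"
  shows "card {j. j < m \<and> (\<exists>k\<ge>1. y k \<in> block s h (2 * j)) \<and> (\<forall>k\<ge>1. y k \<notin> block s h (2 * j + 1))}
     \<le> card {k. k < L \<and> h \<le> min (y (Suc k)) t - min (y k) t}"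
    (is "card ?J \<le> card ?K")
proof (rule card_inj_on_le)
  define \<kappa> where "\<kappa> j = Max {k. 1 \<le> k \<and> y k \<in> block s h (2 * j)}" for j
  have le_t: "real (2 * j + 2) * h \<le> real (2 * m) * h" if "j < m" for j
    using that h by (intro mult_right_mono) auto
  have fin: "finite {k. 1 \<le> k \<and> y k \<in> block s h (2 * j)}" if "j < m" for j
  proof (rule finite_subset)
    show "{k. 1 \<le> k \<and> y k \<in> block s h (2 * j)} \<subseteq> {..<L}"
    proof safe
      fix k assume "y k \<in> block s h (2 * j)"
      then have "y k < s + real (2 * j + 1) * h" by (auto simp: block_def)
      also have "\<dots> \<le> t" using le_t[OF that] t h by (auto simp: algebra_simps)
      finally have "y k < y L" using L by simp
      then show "k < L" using mono by (metis linorder_not_less monoD)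
    qed
  qed simp
  have \<kappa>: "1 \<le> \<kappa> j \<and> y (\<kappa> j) \<in> block s h (2 * j)" if "j \<in> ?J" for j
  proof -
    have "\<kappa> j \<in> {k. 1 \<le> k \<and> y k \<in> block s h (2 * j)}"
      unfolding \<kappa>_def using that fin by (intro Max_in) auto
    then show ?thesis by simp
  qed
  show "inj_on \<kappa> ?J"
  proof (rule inj_onI)
    fix i j assume ij: "i \<in> ?J" "j \<in> ?J" "\<kappa> i = \<kappa> j"
    then have "y (\<kappa> i) \<in> block s h (2 * i) \<inter> block s h (2 * j)"
      using \<kappa>[OF ij(1)] \<kappa>[OF ij(2)] by simp
    moreover have "disjoint_family (block s h)" using h by (simp add: disjoint_family_block)
    ultimately show "i = j"
      using disjoint_family_onD[of "block s h" UNIV "2 * i" "2 * j"] by auto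
  qed
  show "\<kappa> ` ?J \<subseteq> ?K"
  proof (rule image_subsetI)
    fix j assume "j \<in> ?J"
    then have j: "j < m" "\<exists>k\<ge>1. y k \<in> block s h (2 * j)" "\<forall>k\<ge>1. y k \<notin> block s h (2 * j + 1)" by auto
    then have k: "1 \<le> \<kappa> j" "y (\<kappa> j) \<in> block s h (2 * j)" using \<kappa>[of j] by auto
    have "y (Suc (\<kappa> j)) \<notin> block s h (2 * j)"
    proof
      assume "y (Suc (\<kappa> j)) \<in> block s h (2 * j)"
      then have "Suc (\<kappa> j) \<le> \<kappa> j" unfolding \<kappa>_def using fin[OF j(1)] by (intro Max_ge) auto
      then show False by simp
    qed
    moreover have "y (Suc (\<kappa> j)) \<notin> block s h (2 * j + 1)" using j(3) by simp
    moreover have "y (\<kappa> j) \<le> y (Suc (\<kappa> j))" using mono by (simp add: monoD)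
    ultimately have "s + real (2 * j + 2) * h \<le> y (Suc (\<kappa> j))"
      using k by (auto simp: block_def not_less)
    moreover have u: "y (\<kappa> j) < s + real (2 * j + 1) * h" using k by (auto simp: block_def)
    moreover have "real (2 * j + 2) * h = real (2 * j + 1) * h + h" by (simp add: algebra_simps)
    ultimately have "h \<le> min (y (Suc (\<kappa> j))) t - min (y (\<kappa> j)) t"
      using le_t[OF j(1)] t h by linarith
    have "y (\<kappa> j) < y L" using u le_t[OF j(1)] t L h \<open>real (2 * j + 2) * h = real (2 * j + 1) * h + h\<close> by linarith
    then have "\<kappa> j < L" using mono by (metis linorder_not_less monoD)
    with \<open>h \<le> _\<close> show "\<kappa> j \<in> ?K" by simp
  qed
qed simp

section \<open>The walk as a sum of legs\<close>

text \<open>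
  The part of the \<open>k\<close>-th flight that is completed by time \<open>t\<close>. It vanishes for flights that start after
  \<open>t\<close>, so the walk becomes a sum over a deterministic range of indices.
\<close>

definition leg :: "(nat \<Rightarrow> real) \<Rightarrow> real \<Rightarrow> nat \<Rightarrow> real" where
  "leg y t k = min (y (Suc k)) t - min (y k) t"

lemma walk_eq_sum_legs:
  assumes mono: "mono (\<lambda>k. \<tau> k \<omega>)" and start: "\<tau> 0 \<omega> = 0" and t: "0 \<le> t" and L: "t < \<tau> L \<omega>"
  shows "walk \<tau> f t \<omega> = (\<Sum>k<L. leg (\<lambda>k. \<tau> k \<omega>) t k *\<^sub>R f k \<omega>)"
proof -
  define N where "N = turns \<tau> t \<omega>"
  let ?S = "{k. \<tau> k \<omega> \<le> t}"
  have less: "k < L" if "\<tau> k \<omega> \<le> t" for k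
    using monoD[OF mono, of L k] L that by linarith
  then have "?S \<subseteq> {..<L}" by auto
  then have fin: "finite ?S" by (rule finite_subset) simp
  have "0 \<in> ?S" using start t by simp
  then have ne: "?S \<noteq> {}" by blast
  have N: "N = Max ?S"  unfolding N_def turns_def by (rule cSup_eq_Max[OF fin ne])
  then have N2: "\<tau> N \<omega> \<le> t" using Max_in[OF fin ne] by simp
  have after: "t < \<tau> k \<omega>" if "N < k" for k

  proof (rule ccontr)
    assume "\<not> t < \<tau> k \<omega>"
    then have "k \<le> N" unfolding N by (intro Max_ge[OF fin]) simp
    with that show False by simp
  qed
  have before: "\<tau> k \<omega> \<le> t" if "k \<le> N" for k
    using monoD[OF mono that] N2 by simp
  have "(\<Sum>k<L. leg (\<lambda>k. \<tau> k \<omega>) t k *\<^sub>R f k \<omega>) = (\<Sum>k<Suc N. leg (\<lambda>k. \<tau> k \<omega>) t k *\<^sub>R f k \<omega>)"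
  proof (rule sum.mono_neutral_right)
    show "{..<Suc N} \<subseteq> {..<L}" using less[OF N2] by auto
    show "\<forall>k\<in>{..<L} - {..<Suc N}. leg (\<lambda>k. \<tau> k \<omega>) t k *\<^sub>R f k \<omega> = 0"
    proof
      fix k assume "k \<in> {..<L} - {..<Suc N}"
      then have "N < k" "N < Suc k" by auto
      then show "leg (\<lambda>k. \<tau> k \<omega>) t k *\<^sub>R f k \<omega> = 0"
        using after[of k] after[of "Suc k"] by (simp add: leg_def)
    qed
  qed simp
  also have "\<dots> = (\<Sum>k<N. leg (\<lambda>k. \<tau> k \<omega>) t k *\<^sub>R f k \<omega>) + leg (\<lambda>k. \<tau> k \<omega>) t N *\<^sub>R f N \<omega>" by simp
  also have "leg (\<lambda>k. \<tau> k \<omega>) t N = t - \<tau> N \<omega>"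
    using after[of "Suc N"] before[of N] by (simp add: leg_def)
  also have "(\<Sum>k<N. leg (\<lambda>k. \<tau> k \<omega>) t k *\<^sub>R f k \<omega>) = (\<Sum>k<N. (\<tau> (Suc k) \<omega> - \<tau> k \<omega>) *\<^sub>R f k \<omega>)"
    by (intro sum.cong refl) (simp add: leg_def before)
  finally show ?thesis by (simp add: walk_def N_def)
qed

lemma sum_legs_lipschitz:
  fixes g :: "nat \<Rightarrow> 'b::real_normed_vector"
  assumes mono: "mono y" and t: "y 0 \<le> s" "s \<le> t" "t \<le> y L" and g: "\<And>k. norm (g k) \<le> 1"
  shows "norm ((\<Sum>k<L. leg y t k *\<^sub>R g k) - (\<Sum>k<L. leg y s k *\<^sub>R g k)) \<le> t - s"
proof -
  have tel: "(\<Sum>k<L. leg y u k) = min (y L) u - min (y 0) u" for u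
    unfolding leg_def by (rule sum_lessThan_telescope)
  have le: "leg y s k \<le> leg y t k" for k
    using monoD[OF mono, of k "Suc k"] t by (auto simp: leg_def)
  have "norm ((\<Sum>k<L. leg y t k *\<^sub>R g k) - (\<Sum>k<L. leg y s k *\<^sub>R g k)) =
      norm (\<Sum>k<L. (leg y t k - leg y s k) *\<^sub>R g k)" by (simp add: sum_subtractf scaleR_diff_left)
  also have "\<dots> \<le> (\<Sum>k<L. (leg y t k - leg y s k) * 1)"
  proof (rule sum_norm_le)
    fix k
    have "norm ((leg y t k - leg y s k) *\<^sub>R g k) = (leg y t k - leg y s k) * norm (g k)"
      using le[of k] by simp
    also have "\<dots> \<le> (leg y t k - leg y s k) * 1" using le[of k] g by (intro mult_left_mono) auto
    finally show "norm ((leg y t k - leg y s k) *\<^sub>R g k) \<le> (leg y t k - leg y s k) * 1" .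
  qed
  also have "\<dots> = t - s" using t by (simp add: sum_subtractf tel)
  finally show ?thesis .
qed

section \<open>The probability of being near the origin at a given time\<close>

context random_flight begin

lemma AE_regular_path:
  "AE \<omega> in M. mono (\<lambda>k. \<tau> k \<omega>) \<and> \<tau> 0 \<omega> = 0 \<and> filterlim (\<lambda>k. \<tau> k \<omega>) at_top sequentially \<and>
     (\<forall>k. norm (f k \<omega>) = 1)"
proof -
  have rv: "random_variable borel (f k)" for k using directions_indep by (auto simp: indep_vars_def)
  have "AE \<omega> in M. norm (f k \<omega>) = 1" for k
  proof -
    have "AE x in distr M borel (f k). x \<in> sphere 0 1"
      unfolding directions_uniform by (rule AE_uniform_sphere)
    then have "AE \<omega> in M. f k \<omega> \<in> sphere 0 1" by (rule AE_distrD[OF rv])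
    then show ?thesis by (simp only: mem_sphere_0)
  qed
  then have "AE \<omega> in M. \<forall>k. norm (f k \<omega>) = 1" unfolding AE_all_countable by blast
  then show ?thesis
    using points_nonneg points_increasing locally_finite AE_space
  proof eventually_elim
    case (elim \<omega>)
    have "\<tau> k \<omega> \<le> \<tau> (Suc k) \<omega>" for k
    proof (cases "k = 0")
      case True then show ?thesis using elim(2) start[OF elim(5)] by simp
    next
      case False
      then have "\<tau> k \<omega> < \<tau> (Suc k) \<omega>" by (intro strict_mono_onD[OF elim(3)]) simp_all
      then show ?thesis by simp
    qed
    then have "mono (\<lambda>k. \<tau> k \<omega>)" by (simp add: mono_iff_le_Suc)
    then show ?case using elim(1,4) start[OF elim(5)] by blast
  qed
qed

text \<open>
  The finiteness of the point configuration matters here: \<^const>\<open>point_count\<close> is a cardinality, and the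
  value zero excludes points in the block only if finitely many points could lie in it.
\<close>

lemma gap_starts_le_long_legs:
  assumes mono: "mono (\<lambda>k. \<tau> k \<omega>)" and L: "t < \<tau> L \<omega>" and h: "0 < h" and t: "s + real (2 * m) * h \<le> t"
  shows "card {j. j < m \<and> gap_start \<tau> s h j \<omega>} \<le> card {k \<in> {..<L}. h \<le> leg (\<lambda>k. \<tau> k \<omega>) t k}"
proof -
  let ?P = "\<lambda>i. {k. 1 \<le> k \<and> \<tau> k \<omega> \<in> block s h i}"
  have fin: "finite (?P (2 * j + 1))" if "j < m" for j
  proof (rule finite_subset)
    have e: "real (Suc (2 * j + 1)) * h \<le> real (2 * m) * h" using that h by (intro mult_right_mono) auto
    show "?P (2 * j + 1) \<subseteq> {..<L}"
    proof
      fix k assume "k \<in> ?P (2 * j + 1)"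
      then have "\<tau> k \<omega> < s + real (Suc (2 * j + 1)) * h" unfolding block_def by simp
      also have "\<dots> \<le> s + real (2 * m) * h" using e by simp
      also have "\<dots> < \<tau> L \<omega>" using t L by simp
      finally have "\<not> L \<le> k" using monoD[OF mono, of L k] by auto
      then show "k \<in> {..<L}" by simp
    qed
  qed simp
  have "{j. j < m \<and> gap_start \<tau> s h j \<omega>} \<subseteq> {j. j < m \<and> (\<exists>k\<ge>1. \<tau> k \<omega> \<in> block s h (2 * j)) \<and> (\<forall>k\<ge>1. \<tau> k \<omega> \<notin> block s h (2 * j + 1))}"
  proof
    fix j assume "j \<in> {j. j < m \<and> gap_start \<tau> s h j \<omega>}"
    then have j: "j < m" "card (?P (2 * j)) \<noteq> 0" "card (?P (2 * j + 1)) = 0" 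
      unfolding mem_Collect_eq gap_start_def point_count_def by linarith+
    have "?P (2 * j + 1) = {}" using j(3) fin[OF j(1)] by (metis card_0_eq)
    moreover have "?P (2 * j) \<noteq> {}" using j(2) by (metis card.empty)
    ultimately show "j \<in> {j. j < m \<and> (\<exists>k\<ge>1. \<tau> k \<omega> \<in> block s h (2 * j)) \<and> (\<forall>k\<ge>1. \<tau> k \<omega> \<notin> block s h (2 * j + 1))}"
      using j(1) by blast
  qed
  then have "card {j. j < m \<and> gap_start \<tau> s h j \<omega>} \<le> card {j. j < m \<and> (\<exists>k\<ge>1. \<tau> k \<omega> \<in> block s h (2 * j)) \<and> (\<forall>k\<ge>1. \<tau> k \<omega> \<notin> block s h (2 * j + 1))}"
    by (rule card_mono[rotated]) simp
  also have "\<dots> \<le> card {k. k < L \<and> h \<le> min (\<tau> (Suc k) \<omega>) t - min (\<tau> k \<omega>) t}"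
    by (rule card_gap_starts_le[OF mono L h t])
  finally show ?thesis by (simp add: leg_def)
qed

text \<open>
  Given the turning times, the legs have fixed lengths and \<open>small_ball_fixed_steps\<close> applies.
\<close>

lemma prob_long_legs_near_origin_le:
  fixes L :: nat and t R n :: real
  assumes dim: "CARD('n) \<ge> 2"
    and c: "0 < c" "\<And>v :: real ^ 'n. norm (\<integral>x. cis (v \<bullet> x) \<partial>uniform_sphere) \<le> exp (- c * min 1 ((norm v)\<^sup>2))"
    and a: "0 < a" and n: "0 < n"
  defines "E \<equiv> {\<omega> \<in> space M. n \<le> card {k \<in> {..<L}. a \<le> leg (\<lambda>k. \<tau> k \<omega>) t k} \<and>
       norm (\<Sum>k<L. leg (\<lambda>k. \<tau> k \<omega>) t k *\<^sub>R f k \<omega>) \<le> R}"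
  shows "E \<in> events" "prob E \<le> exp (R\<^sup>2 / 2) * (exp (- c * n) + 1 / (2 * (c * n * a\<^sup>2)))"
proof -
  define N1 where "N1 = (\<Pi>\<^sub>M k\<in>(UNIV :: nat set). (borel :: (real ^ 'n) measure))"
  define N2 where "N2 = (\<Pi>\<^sub>M k\<in>{1 :: nat..}. (borel :: real measure))"
  define X where "X = (\<lambda>\<omega> k. f k \<omega>)"
  define Y where "Y = (\<lambda>\<omega>. \<lambda>k\<in>{1::nat..}. \<tau> k \<omega>)"
  have rvf [measurable]: "random_variable borel (f k)" for k using directions_indep by (auto simp: indep_vars_def)
  note points_measurable [measurable]
  have card_eq: "real (card {k \<in> {..<L}. a \<le> l k}) = (\<Sum>k<L. if a \<le> l k then 1 else 0)" for l :: "nat \<Rightarrow> real"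
    by (simp add: sum.If_cases Int_def)
  show "E \<in> events" unfolding E_def card_eq leg_def by measurable
  \<comment> \<open>The independence assumption concerns the times with index at least one; the starting time is
    restored by hand, as the restricted sequence takes an arbitrary value at zero.\<close>
  define l where "l y = leg (y(0 := 0)) t" for y
  define G where "G = {p \<in> space (N1 \<Otimes>\<^sub>M N2). n \<le> (\<Sum>k<L. if a \<le> l (snd p) k then 1 else 0) \<and>
     norm (\<Sum>k<L. l (snd p) k *\<^sub>R fst p k) \<le> R}"
  have m2: "(\<lambda>p. ((snd p)(0 := 0)) k) \<in> borel_measurable (N1 \<Otimes>\<^sub>M N2)" for k
  proof (cases "k = 0")
    case False
    then have "(\<lambda>y. y k) \<in> borel_measurable N2" unfolding N2_def by (intro measurable_component_singleton) auto
    then have "(\<lambda>p. snd p k) \<in> borel_measurable (N1 \<Otimes>\<^sub>M N2)" by (rule measurable_compose[OF measurable_snd])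
    then show ?thesis using False by simp
  qed simp
  have [measurable]: "(\<lambda>p. l (snd p) k) \<in> borel_measurable (N1 \<Otimes>\<^sub>M N2)" for k
    unfolding l_def leg_def by (intro borel_measurable_diff borel_measurable_min m2 borel_measurable_const)
  have [measurable]: "(\<lambda>p. fst p k) \<in> borel_measurable (N1 \<Otimes>\<^sub>M N2)" for k
    unfolding N1_def by (rule measurable_compose[OF measurable_fst measurable_component_singleton]) simp
  have G: "G \<in> sets (N1 \<Otimes>\<^sub>M N2)" unfolding G_def by measurable
  have XY: "X \<in> space M \<rightarrow> space N1" "Y \<in> space M \<rightarrow> space N2"
    by (auto simp: X_def Y_def N1_def N2_def space_PiM)
  have l_Y: "l (Y \<omega>) = leg (\<lambda>k. \<tau> k \<omega>) t" if "\<omega> \<in> space M" for \<omega>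
    using start[OF that] by (intro ext) (simp add: l_def leg_def Y_def)
  have "prob {\<omega> \<in> space M. (X \<omega>, Y \<omega>) \<in> G} \<le> exp (R\<^sup>2 / 2) * (exp (- c * n) + 1 / (2 * (c * n * a\<^sup>2)))"
  proof (rule prob_le_of_indep_section[OF XY _ G])
    show "indep_set (sets (vimage_algebra (space M) X N1)) (sets (vimage_algebra (space M) Y N2))"
      using directions_indep_points by (simp add: X_def Y_def N1_def N2_def)
    fix y assume y: "y \<in> space N2"
    show "prob {\<omega> \<in> space M. (X \<omega>, y) \<in> G} \<le> exp (R\<^sup>2 / 2) * (exp (- c * n) + 1 / (2 * (c * n * a\<^sup>2)))"
    proof (cases "n \<le> card {k \<in> {..<L}. a \<le> l y k}")
      case True
      have "{\<omega> \<in> space M. (X \<omega>, y) \<in> G} = {\<omega> \<in> space M. norm (\<Sum>k<L. l y k *\<^sub>R f k \<omega>) \<le> R}"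
        using True XY(1) y unfolding G_def card_eq[symmetric] by (auto simp: space_pair_measure X_def Pi_def)
      also have "prob \<dots> \<le> exp (R\<^sup>2 / 2) * (exp (- c * n) + 1 / (2 * (c * n * a\<^sup>2)))"
        by (rule small_ball_fixed_steps[OF dim _ _ c _ a n True])
           (use indep_vars_subset[OF directions_indep subset_UNIV] directions_uniform in simp_all)
      finally show ?thesis .
    next
      case False
      then have "{\<omega> \<in> space M. (X \<omega>, y) \<in> G} = {}" unfolding G_def card_eq[symmetric] by auto
      then have "prob {\<omega> \<in> space M. (X \<omega>, y) \<in> G} = 0" by (simp only: measure_empty)
      also have "0 \<le> exp (R\<^sup>2 / 2) * (exp (- c * n) + 1 / (2 * (c * n * a\<^sup>2)))"
        using c(1) n a by (intro mult_nonneg_nonneg add_nonneg_nonneg) simp_all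
      finally show ?thesis .
    qed
  qed
  also have "{\<omega> \<in> space M. (X \<omega>, Y \<omega>) \<in> G} = E"
    using XY unfolding G_def E_def card_eq[symmetric]
    by (auto simp: space_pair_measure l_Y Pi_def) (auto simp: X_def)
  finally show "prob E \<le> exp (R\<^sup>2 / 2) * (exp (- c * n) + 1 / (2 * (c * n * a\<^sup>2)))" .
qed

text \<open>
  The truncation index \<open>L\<close> does not occur in the bound. Hence the event \<open>t < \<tau> L\<close>, on which the sum of
  legs is the position of the walk, costs nothing when \<open>L\<close> is large.
\<close>

lemma prob_near_origin_le:
  assumes dim: "CARD('n) \<ge> 2"
    and c: "0 < c" "\<And>v :: real ^ 'n. norm (\<integral>x. cis (v \<bullet> x) \<partial>uniform_sphere) \<le> exp (- c * min 1 ((norm v)\<^sup>2))"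
    and s: "0 \<le> s" and h: "0 < h" and m: "0 < m" and t: "s + real (2 * m) * h \<le> t"
    and b1: "\<And>j. j < m \<Longrightarrow> b1 \<le> (LINT t:block s h (2 * j)|lborel. r t)" "0 < b1"
    and b2: "\<And>j. j < m \<Longrightarrow> (LINT t:block s h (2 * j + 1)|lborel. r t) \<le> b2"
    and \<kappa>: "\<kappa> = (1 - exp (- 1)) * ((1 - exp (- b1)) * exp (- b2))"
  shows "prob {\<omega> \<in> space M. t < \<tau> L \<omega> \<and> norm (\<Sum>k<L. leg (\<lambda>k. \<tau> k \<omega>) t k *\<^sub>R f k \<omega>) \<le> R}
     \<le> exp (- (\<kappa> / 2) * m) +
        exp (R\<^sup>2 / 2) * (exp (- c * (\<kappa> / 2 * m)) + 1 / (2 * (c * (\<kappa> / 2 * m) * h\<^sup>2)))"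
proof -
  have rvf [measurable]: "random_variable borel (f k)" for k using directions_indep by (auto simp: indep_vars_def)
  note points_measurable [measurable]
  have h': "0 \<le> h" using h by simp
  have "0 < \<kappa>" unfolding \<kappa> using b1 by simp
  then have n: "0 < \<kappa> / 2 * m" using m by simp
  let ?A = "{\<omega> \<in> space M. real (card {j. j < m \<and> gap_start \<tau> s h j \<omega>}) \<le> \<kappa> / 2 * m}"
  let ?B = "{\<omega> \<in> space M. \<kappa> / 2 * m \<le> card {k \<in> {..<L}. h \<le> leg (\<lambda>k. \<tau> k \<omega>) t k} \<and>
       norm (\<Sum>k<L. leg (\<lambda>k. \<tau> k \<omega>) t k *\<^sub>R f k \<omega>) \<le> R}"
  let ?E = "{\<omega> \<in> space M. t < \<tau> L \<omega> \<and> norm (\<Sum>k<L. leg (\<lambda>k. \<tau> k \<omega>) t k *\<^sub>R f k \<omega>) \<le> R}"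
  note A = prob_few_gap_starts_le[OF s h' b1(1) b2 \<kappa>]
  note B = prob_long_legs_near_origin_le[OF dim c h n, where L=L and t=t and R=R]
  have "AE \<omega> in M. \<omega> \<in> ?E \<longrightarrow> \<omega> \<in> ?A \<union> ?B"
    using AE_regular_path
  proof eventually_elim
    case (elim \<omega>)
    show ?case
    proof
      assume "\<omega> \<in> ?E"
      then have E: "\<omega> \<in> space M" "t < \<tau> L \<omega>" "norm (\<Sum>k<L. leg (\<lambda>k. \<tau> k \<omega>) t k *\<^sub>R f k \<omega>) \<le> R"
        unfolding mem_Collect_eq by blast+
      have "card {j. j < m \<and> gap_start \<tau> s h j \<omega>} \<le> card {k \<in> {..<L}. h \<le> leg (\<lambda>k. \<tau> k \<omega>) t k}"
        by (rule gap_starts_le_long_legs[OF conjunct1[OF elim] E(2) h t])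
      then have "real (card {j. j < m \<and> gap_start \<tau> s h j \<omega>}) \<le> \<kappa> / 2 * m \<or>
          \<kappa> / 2 * m \<le> card {k \<in> {..<L}. h \<le> leg (\<lambda>k. \<tau> k \<omega>) t k}" by linarith
      then show "\<omega> \<in> ?A \<union> ?B" using E(1,3) unfolding Un_iff mem_Collect_eq by blast
    qed
  qed
  then have "prob ?E \<le> prob (?A \<union> ?B)"
    by (rule finite_measure_mono_AE[OF _ sets.Un[OF A(1) B(1)]])
  also have "\<dots> \<le> prob ?A + prob ?B" using A(1) B(1) by (rule measure_Un_le)
  also have "\<dots> \<le> exp (- (\<kappa> / 2) * m) +
        exp (R\<^sup>2 / 2) * (exp (- c * (\<kappa> / 2 * m)) + 1 / (2 * (c * (\<kappa> / 2 * m) * h\<^sup>2)))"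
    by (rule add_mono[OF A(2) B(2)])
  finally show ?thesis .
qed

lemma prob_point_le_tendsto_0: "(\<lambda>L. prob {\<omega> \<in> space M. \<tau> L \<omega> \<le> t}) \<longlonglongrightarrow> 0"
proof -
  note points_measurable [measurable]
  have "(\<lambda>L. \<integral>\<omega>. indicator {\<omega> \<in> space M. \<tau> L \<omega> \<le> t} \<omega> \<partial>M) \<longlonglongrightarrow> (\<integral>\<omega>. 0 \<partial>M :: real)"
  proof (rule integral_dominated_convergence[where w="\<lambda>_. 1"])
    show "AE \<omega> in M. (\<lambda>L. indicator {\<omega> \<in> space M. \<tau> L \<omega> \<le> t} \<omega> :: real) \<longlonglongrightarrow> 0"
      using locally_finite
    proof eventually_elim
      case (elim \<omega>)
      then have "\<forall>\<^sub>F L in sequentially. t < \<tau> L \<omega>" by (simp add: filterlim_at_top_dense)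
      then have "\<forall>\<^sub>F L in sequentially. indicator {\<omega> \<in> space M. \<tau> L \<omega> \<le> t} \<omega> = (0 :: real)"
        by eventually_elim auto
      then show ?case by (rule tendsto_eventually)
    qed
  qed auto
  then show ?thesis by (simp add: Int_absorb2 subset_eq)
qed

end

section \<open>From summability to transience\<close>

lemma recurrent_path_near_origin_at_integers:
  fixes f :: "nat \<Rightarrow> 'w \<Rightarrow> real ^ 'n"
  assumes mono: "mono (\<lambda>k. \<tau> k \<omega>)" and start: "\<tau> 0 \<omega> = 0"
    and lim: "filterlim (\<lambda>k. \<tau> k \<omega>) at_top sequentially"
    and f: "\<And>k. norm (f k \<omega>) = 1"
    and rec: "recurrent_path \<rho> (\<lambda>t. walk \<tau> f t \<omega>)"
  shows "\<exists>\<^sub>F n in sequentially. norm (walk \<tau> f (real n) \<omega>) \<le> real CARD('n) * \<rho> + 1"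
proof -
  obtain t :: "nat \<Rightarrow> real" where t: "\<And>i. 0 \<le> t i" "filterlim t at_top sequentially"
    "\<And>i. walk \<tau> f (t i) \<omega> \<in> cbox (\<chi> j. - \<rho>) (\<chi> j. \<rho>)"
    using rec unfolding recurrent_path_def by blast
  show ?thesis
    unfolding frequently_sequentially
  proof
    fix N :: nat
    have "\<forall>\<^sub>F i in sequentially. real N \<le> t i" using t(2) by (simp add: filterlim_at_top)
    then obtain i where i: "real N \<le> t i" by (auto simp: eventually_sequentially)
    define n where "n = nat \<lceil>t i\<rceil>"
    have n: "t i \<le> real n" "real n \<le> t i + 1" using t(1)[of i] unfolding n_def by linarith+
    have "\<forall>\<^sub>F L in sequentially. real n < \<tau> L \<omega>" using lim by (simp add: filterlim_at_top_dense)
    then obtain L where L: "real n < \<tau> L \<omega>" by (auto simp: eventually_sequentially)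
    have "norm (walk \<tau> f (real n) \<omega> - walk \<tau> f (t i) \<omega>) \<le> real n - t i"
    proof (subst (1 2) walk_eq_sum_legs[where \<tau>=\<tau> and \<omega>=\<omega> and f=f and L=L, OF mono start])
      show "norm ((\<Sum>k<L. leg (\<lambda>k. \<tau> k \<omega>) (real n) k *\<^sub>R f k \<omega>) - (\<Sum>k<L. leg (\<lambda>k. \<tau> k \<omega>) (t i) k *\<^sub>R f k \<omega>)) \<le> real n - t i"
        by (rule sum_legs_lipschitz[OF mono]) (use start t(1)[of i] n L f in auto)
    qed (use t(1)[of i] n L in linarith)+
    then have "norm (walk \<tau> f (real n) \<omega> - walk \<tau> f (t i) \<omega>) \<le> 1" using n by linarith
    moreover have "norm (walk \<tau> f (t i) \<omega>) \<le> real CARD('n) * \<rho>"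
    proof -
      have "norm (walk \<tau> f (t i) \<omega>) \<le> (\<Sum>j\<in>UNIV. \<bar>walk \<tau> f (t i) \<omega> $ j\<bar>)" by (rule norm_le_l1_cart)
      also have "\<dots> \<le> (\<Sum>j\<in>(UNIV :: 'n set). \<rho>)"
        using t(3)[of i] by (intro sum_mono) (auto simp: mem_box_cart abs_le_iff minus_le_iff)
      finally show ?thesis by simp
    qed
    moreover have "norm (walk \<tau> f (real n) \<omega>) \<le> norm (walk \<tau> f (real n) \<omega> - walk \<tau> f (t i) \<omega>) + norm (walk \<tau> f (t i) \<omega>)"
      using norm_triangle_ineq[of "walk \<tau> f (real n) \<omega> - walk \<tau> f (t i) \<omega>" "walk \<tau> f (t i) \<omega>"] by simp
    ultimately have "norm (walk \<tau> f (real n) \<omega>) \<le> real CARD('n) * \<rho> + 1" by linarith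
    moreover have "N \<le> n" using i n by linarith
    ultimately show "\<exists>n\<ge>N. norm (walk \<tau> f (real n) \<omega>) \<le> real CARD('n) * \<rho> + 1" by blast
  qed
qed

context random_flight begin

text \<open>
  For each \<open>n\<close> the index \<open>L n\<close> is taken so large that the time \<open>n\<close> lies before \<open>\<tau> (L n)\<close> with
  probability at least \<open>1 - 2\<^sup>-\<^sup>n\<close>. Borel-Cantelli is applied to the events that this fails or that the
  sum of the first \<open>L n\<close> legs lies within distance \<open>R\<close> of the origin. These are measurable by construction.
\<close>

lemma AE_transient_of_summable:
  assumes B: "\<And>R. \<exists>B. summable B \<and> (\<forall>\<^sub>F n in sequentially. \<forall>L.
     prob {\<omega> \<in> space M. real n < \<tau> L \<omega> \<and> norm (\<Sum>k<L. leg (\<lambda>k. \<tau> k \<omega>) (real n) k *\<^sub>R f k \<omega>) \<le> R} \<le> B n)"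
  shows "AE \<omega> in M. transient_path (\<lambda>t. walk \<tau> f t \<omega>)"
proof -
  have rvf [measurable]: "random_variable borel (f k)" for k using directions_indep by (auto simp: indep_vars_def)
  note points_measurable [measurable]
  have "\<exists>L. prob {\<omega> \<in> space M. \<tau> L \<omega> \<le> real n} < (1/2) ^ n" for n
  proof -
    have "\<forall>\<^sub>F L in sequentially. prob {\<omega> \<in> space M. \<tau> L \<omega> \<le> real n} < (1/2) ^ n"
      by (rule order_tendstoD(2)[OF prob_point_le_tendsto_0]) simp
    then show ?thesis by (auto simp: eventually_sequentially)
  qed
  then obtain L where L: "\<And>n. prob {\<omega> \<in> space M. \<tau> (L n) \<omega> \<le> real n} < (1/2) ^ n" by metis
  have far: "AE \<omega> in M. \<forall>\<^sub>F n in sequentially. R < norm (walk \<tau> f (real n) \<omega>)" for R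
  proof -
    obtain B where B: "summable B" "\<forall>\<^sub>F n in sequentially. \<forall>L.
       prob {\<omega> \<in> space M. real n < \<tau> L \<omega> \<and> norm (\<Sum>k<L. leg (\<lambda>k. \<tau> k \<omega>) (real n) k *\<^sub>R f k \<omega>) \<le> R} \<le> B n"
      using assms[of R] by blast
    define A1 where "A1 n = {\<omega> \<in> space M. \<tau> (L n) \<omega> \<le> real n}" for n
    define A2 where "A2 n = {\<omega> \<in> space M. real n < \<tau> (L n) \<omega> \<and>
       norm (\<Sum>k<L n. leg (\<lambda>k. \<tau> k \<omega>) (real n) k *\<^sub>R f k \<omega>) \<le> R}" for n
    have m: "A1 n \<in> events" "A2 n \<in> events" for n unfolding A1_def A2_def leg_def by measurable
    have "summable (\<lambda>n. prob (A1 n \<union> A2 n))"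
    proof (rule summable_comparison_test_ev)
      show "summable (\<lambda>n. (1/2) ^ n + B n)" using B(1) by (intro summable_add) simp_all
      show "\<forall>\<^sub>F n in sequentially. norm (prob (A1 n \<union> A2 n)) \<le> (1/2) ^ n + B n"
        using B(2)
      proof eventually_elim
        case (elim n)
        have "prob (A1 n \<union> A2 n) \<le> prob (A1 n) + prob (A2 n)" by (rule measure_Un_le[OF m])
        also have "\<dots> \<le> (1/2) ^ n + B n"
          using L[of n] elim[rule_format, of "L n"] unfolding A1_def A2_def by (intro add_mono) auto
        finally show ?case by simp
      qed
    qed
    then have "AE \<omega> in M. \<forall>\<^sub>F n in sequentially. \<omega> \<in> space M - (A1 n \<union> A2 n)"
      by (intro borel_cantelli_AE1) (use m in \<open>auto simp: emeasure_eq_measure\<close>)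
    with AE_regular_path show ?thesis
    proof eventually_elim
      case (elim \<omega>)
      note w = walk_eq_sum_legs[where \<tau>=\<tau> and \<omega>=\<omega> and f=f, OF conjunct1[OF elim(1)] conjunct1[OF conjunct2[OF elim(1)]]]
      show ?case using elim(2)
      proof eventually_elim
        case (elim n)
        then have "real n < \<tau> (L n) \<omega>" by (simp add: A1_def not_le)
        with elim show "R < norm (walk \<tau> f (real n) \<omega>)"
          by (subst w[where L="L n"]) (simp_all add: A2_def not_le)
      qed
    qed
  qed
  then have "AE \<omega> in M. \<forall>R::nat. \<forall>\<^sub>F n in sequentially. real R < norm (walk \<tau> f (real n) \<omega>)"
    unfolding AE_all_countable by blast
  with AE_regular_path show ?thesis
  proof eventually_elim
    case (elim \<omega>)
    show ?case unfolding transient_path_def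
    proof safe
      fix \<rho> :: real assume "recurrent_path \<rho> (\<lambda>t. walk \<tau> f t \<omega>)"
      then have freq: "\<exists>\<^sub>F n in sequentially. norm (walk \<tau> f (real n) \<omega>) \<le> real CARD('n) * \<rho> + 1"
        using elim(1) by (intro recurrent_path_near_origin_at_integers) blast+
      obtain R :: nat where R: "real CARD('n) * \<rho> + 1 \<le> real R" using real_arch_simple by blast
      have "\<forall>\<^sub>F n in sequentially. \<not> norm (walk \<tau> f (real n) \<omega>) \<le> real CARD('n) * \<rho> + 1"
        using elim(2)[rule_format, of R] by eventually_elim (use R in linarith)
      with freq show False by (simp add: frequently_def)
    qed
  qed
qed

lemma set_integral_rate_block_bounds:
  assumes s: "0 \<le> s" and h: "0 < h" and block: "block s h i \<subseteq> {a..b}"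
    and r: "\<And>u. u \<in> {a..b} \<Longrightarrow> 1 / h \<le> r u \<and> r u \<le> K / h"
  shows "1 \<le> (LINT t:block s h i|lborel. r t)" "(LINT t:block s h i|lborel. r t) \<le> K"
proof -
  let ?A = "block s h i"
  have A: "?A \<in> sets lborel" "?A \<subseteq> {0..s + real (Suc i) * h}"
    using block_properties[OF s less_imp_le[OF h], of i] by (auto simp: block_def)
  have mA: "measure lborel ?A = h" and eA: "emeasure lborel ?A = ennreal h"
    using h by (simp_all add: block_def algebra_simps)
  have "set_integrable lborel {0..s + real (Suc i) * h} r"
    using rate s h by (simp add: rate_function_def)
  then have ir: "set_integrable lborel ?A r" by (rule set_integrable_subset) (use A in auto)
  have ic: "set_integrable lborel ?A (\<lambda>_. c)" for c :: real
    unfolding set_integrable_def using A(1) eA by (intro integrable_scaleR_left integrable_real_indicator) auto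
  have c: "(LINT t:?A|lborel. c) = h * c" for c :: real
    using A(1) eA by (simp add: set_integral_const mA)
  have "(LINT t:?A|lborel. 1 / h) \<le> (LINT t:?A|lborel. r t)"
    by (rule set_integral_mono[OF ic ir]) (use r block in blast)
  then show "1 \<le> (LINT t:?A|lborel. r t)" using h by (simp add: c)
  have "(LINT t:?A|lborel. r t) \<le> (LINT t:?A|lborel. K / h)"
    by (rule set_integral_mono[OF ir ic]) (use r block in blast)
  then show "(LINT t:?A|lborel. r t) \<le> K" using h by (simp add: c)
qed

text \<open>
  An interval of length \<open>h n\<close> inside \<open>[n/2, n]\<close> contains between \<open>1\<close> and \<open>K\<close> points on average.
  There is room for about \<open>n / (4 (h n))\<close> pairs of such blocks, which yield about as many steps of length at
  least \<open>h n\<close> and therefore a bound of order \<open>1 / (n (h n))\<close>.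
\<close>

lemma AE_transient_of_rate:
  fixes h :: "nat \<Rightarrow> real"
  assumes dim: "CARD('n) \<ge> 2"
    and h: "\<forall>\<^sub>F n in sequentially. 0 < h n \<and> 4 * h n \<le> real n"
    and r: "\<forall>\<^sub>F n in sequentially. \<forall>u\<in>{real n / 2..real n}. 1 / h n \<le> r u \<and> r u \<le> K / h n"
    and sum1: "\<And>c. 0 < c \<Longrightarrow> summable (\<lambda>n. exp (- c * (real n / h n)))"
    and sum2: "summable (\<lambda>n. 1 / (real n * h n))"
  shows "AE \<omega> in M. transient_path (\<lambda>t. walk \<tau> f t \<omega>)"
proof (rule AE_transient_of_summable)
  fix R
  obtain c where c: "0 < c" "\<And>v :: real ^ 'n. norm (\<integral>x. cis (v \<bullet> x) \<partial>uniform_sphere) \<le> exp (- c * min 1 ((norm v)\<^sup>2))"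
    using uniform_sphere_char_bound[OF dim] by blast
  define \<kappa> where "\<kappa> = (1 - exp (- 1)) * ((1 - exp (- 1)) * exp (- K :: real))"
  have \<kappa>: "0 < \<kappa>" unfolding \<kappa>_def by simp
  define B where "B n = exp (- (\<kappa> / 16) * (real n / h n)) +
      exp (R\<^sup>2 / 2) * (exp (- (c * \<kappa> / 16) * (real n / h n)) + 8 / (c * \<kappa>) * (1 / (real n * h n)))" for n
  have "summable B" unfolding B_def
    by (intro summable_add summable_mult sum1 sum2) (use \<kappa> c in auto)
  moreover have "\<forall>\<^sub>F n in sequentially. \<forall>L.
     prob {\<omega> \<in> space M. real n < \<tau> L \<omega> \<and> norm (\<Sum>k<L. leg (\<lambda>k. \<tau> k \<omega>) (real n) k *\<^sub>R f k \<omega>) \<le> R} \<le> B n"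
    using h r
  proof eventually_elim
    case (elim n)
    then have h: "0 < h n" "4 * h n \<le> real n"
      and r: "\<And>u. u \<in> {real n / 2..real n} \<Longrightarrow> 1 / h n \<le> r u \<and> r u \<le> K / h n" by auto
    define q where "q = real n / (4 * h n)"
    define m where "m = nat \<lfloor>q\<rfloor>"
    have q: "1 \<le> q" using h by (simp add: q_def)
    then have "1 \<le> \<lfloor>q\<rfloor>" by simp
    then have fl: "1 \<le> real_of_int \<lfloor>q\<rfloor>" "real m = real_of_int \<lfloor>q\<rfloor>" "0 < m" unfolding m_def by simp_all
    \<comment> \<open>Rounding down loses at most half, as \<open>q\<close> is at least one.\<close>
    have m: "q / 2 \<le> real m" "real m \<le> q" "0 < m"
      using fl real_of_int_floor_gt_diff_one[of q] of_int_floor_le[of q] by linarith+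
    have n: "0 < real n" using h by linarith
    have "real (2 * m) * h n \<le> 2 * q * h n" using m(2) h by (intro mult_right_mono) auto
    also have "\<dots> = real n / 2" using h by (simp add: q_def)
    finally have t: "real n / 2 + real (2 * m) * h n \<le> real n" by simp
    have bl: "block (real n / 2) (h n) i \<subseteq> {real n / 2..real n}" if "i < 2 * m" for i
    proof -
      have "real (Suc i) * h n \<le> real (2 * m) * h n" using that h by (intro mult_right_mono) auto
      then have "real n / 2 + real (Suc i) * h n \<le> real n" using t by linarith
      moreover have "0 \<le> real i * h n" using h by simp
      ultimately show ?thesis unfolding block_def by (intro subsetI) (simp only: atLeastLessThan_iff atLeastAtMost_iff, linarith)
    qed
    have s: "0 \<le> real n / 2" by simp
    show ?case
    proof
      fix L
      have "prob {\<omega> \<in> space M. real n < \<tau> L \<omega> \<and> norm (\<Sum>k<L. leg (\<lambda>k. \<tau> k \<omega>) (real n) k *\<^sub>R f k \<omega>) \<le> R}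
          \<le> exp (- (\<kappa> / 2) * m) +
             exp (R\<^sup>2 / 2) * (exp (- c * (\<kappa> / 2 * m)) + 1 / (2 * (c * (\<kappa> / 2 * m) * (h n)\<^sup>2)))"
      proof (rule prob_near_origin_le[OF dim c s h(1) m(3) t _ _ _ \<kappa>_def])
        fix j assume "j < m"
        then show "1 \<le> (LINT t:block (real n / 2) (h n) (2 * j)|lborel. r t)"
          "(LINT t:block (real n / 2) (h n) (2 * j + 1)|lborel. r t) \<le> K"
          using set_integral_rate_block_bounds[OF s h(1) bl r, of "2 * j"]
            set_integral_rate_block_bounds[OF s h(1) bl r, of "2 * j + 1"] by auto
      qed simp
      also have "\<dots> \<le> exp (- (\<kappa> / 2) * (q / 2)) +
             exp (R\<^sup>2 / 2) * (exp (- c * (\<kappa> / 2 * (q / 2))) + 1 / (2 * (c * (\<kappa> / 2 * (q / 2)) * (h n)\<^sup>2)))"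
      proof -
        have "- (\<kappa> / 2) * m \<le> - (\<kappa> / 2) * (q / 2)" using m(1) \<kappa> by (intro mult_left_mono_neg) auto
        moreover have *: "c * (\<kappa> / 2 * (q / 2)) \<le> c * (\<kappa> / 2 * m)" using m(1) \<kappa> c(1) by (intro mult_left_mono) auto
        moreover have "1 / (2 * (c * (\<kappa> / 2 * m) * (h n)\<^sup>2)) \<le> 1 / (2 * (c * (\<kappa> / 2 * (q / 2)) * (h n)\<^sup>2))"
        proof (rule divide_left_mono)
          show "2 * (c * (\<kappa> / 2 * (q / 2)) * (h n)\<^sup>2) \<le> 2 * (c * (\<kappa> / 2 * m) * (h n)\<^sup>2)"
            by (rule mult_left_mono[OF mult_right_mono[OF *]]) simp_all
          show "0 < 2 * (c * (\<kappa> / 2 * m) * (h n)\<^sup>2) * (2 * (c * (\<kappa> / 2 * (q / 2)) * (h n)\<^sup>2))"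
            using c(1) \<kappa> m(3) q h(1) by (intro mult_pos_pos zero_less_power) auto
        qed simp
        ultimately show ?thesis by (intro add_mono mult_left_mono) auto
      qed
      also have "\<dots> = B n"
      proof -
        have "1 / (2 * (c * (\<kappa> / 2 * (q / 2)) * (h n)\<^sup>2)) = 8 / (c * \<kappa>) * (1 / (real n * h n))"
          using c(1) \<kappa> h n by (simp add: q_def field_simps power2_eq_square)
        moreover have "- (\<kappa> / 2) * (q / 2) = - (\<kappa> / 16) * (real n / h n)"
          "- c * (\<kappa> / 2 * (q / 2)) = - (c * \<kappa> / 16) * (real n / h n)" by (simp_all add: q_def)
        ultimately show ?thesis by (simp only: B_def)
      qed
      finally show "prob {\<omega> \<in> space M. real n < \<tau> L \<omega> \<and> norm (\<Sum>k<L. leg (\<lambda>k. \<tau> k \<omega>) (real n) k *\<^sub>R f k \<omega>) \<le> R} \<le> B n" .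
    qed
  qed
  ultimately show "\<exists>B. summable B \<and> (\<forall>\<^sub>F n in sequentially. \<forall>L.
     prob {\<omega> \<in> space M. real n < \<tau> L \<omega> \<and> norm (\<Sum>k<L. leg (\<lambda>k. \<tau> k \<omega>) (real n) k *\<^sub>R f k \<omega>) \<le> R} \<le> B n)"
    by blast
qed

end

section \<open>The two families of rate functions\<close>

lemma four_powr_le:
  fixes \<alpha> :: real assumes "\<alpha> < 1"
  shows "\<forall>\<^sub>F n in sequentially. 4 * real n powr \<alpha> \<le> real n"
  using assms by real_asymp

lemma exp_neg_powr_le: fixes \<alpha> c :: real assumes "\<alpha> < 1" "0 < c"
  shows "\<forall>\<^sub>F n in sequentially. exp (- c * (real n / real n powr \<alpha>)) \<le> 1 / real n ^ 2"
  using assms by real_asymp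

lemma exp_neg_log_le: fixes \<beta> c :: real assumes "0 < c" "0 < \<beta>"
  shows "\<forall>\<^sub>F n in sequentially. exp (- c * (real n / ln (real n + 1) powr \<beta>)) \<le> 1 / real n ^ 2"
  using assms by real_asymp

lemma four_ln_powr_le: fixes \<beta> :: real assumes "0 < \<beta>"
  shows "\<forall>\<^sub>F n in sequentially. 4 * ln (real n + 1) powr \<beta> \<le> real n"
  using assms by real_asymp

lemma ln_half_ge: 
  shows "\<forall>\<^sub>F n in sequentially. ln (real n + 1) \<le> 2 * ln (real n / 2)"
  by real_asymp

text \<open>
  Cauchy condensation turns the series into one comparable with \<open>\<Sum> n powr (- \<beta>)\<close>. The argument
  \<open>n + 1\<close> of the logarithm makes the terms decrease from \<open>n = 1\<close> on.
\<close>

lemma summable_log: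
  assumes "1 < \<beta>"
  shows "summable (\<lambda>n. 1 / (real n * ln (real n + 1) powr \<beta>))"
proof -
  let ?f = "\<lambda>n::nat. 1 / (real n * ln (real n + 1) powr \<beta>)"
  have "summable ?f \<longleftrightarrow> summable (\<lambda>n. 2 ^ n * ?f (2 ^ n))"
  proof (rule condensation_test)
    fix m :: nat assume "0 < m"
    then show "?f (Suc m) \<le> ?f m" using assms
      by (intro divide_left_mono mult_mono powr_mono2 mult_pos_pos) auto
  qed simp
  also have "summable (\<lambda>n. 2 ^ n * ?f (2 ^ n))"
  proof (rule summable_comparison_test')
    show "summable (\<lambda>n. ln 2 powr (- \<beta>) * real n powr (- \<beta>))"
      using assms by (intro summable_mult) (simp add: summable_real_powr_iff)
    fix n :: nat assume n: "1 \<le> n"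
    have "real n * ln 2 = ln (2 ^ n)" by (simp add: ln_realpow)
    also have "\<dots> \<le> ln (2 ^ n + 1)" by (subst ln_le_cancel_iff) (simp_all add: add_pos_pos)
    finally have "(real n * ln 2) powr \<beta> \<le> ln (2 ^ n + 1) powr \<beta>" using assms by (intro powr_mono2) auto
    then have "1 / ln (2 ^ n + 1) powr \<beta> \<le> 1 / (real n * ln 2) powr \<beta>"
      using n by (intro divide_left_mono) (auto intro!: mult_pos_pos simp: add_pos_pos)
    also have "\<dots> = ln 2 powr (- \<beta>) * real n powr (- \<beta>)"
      by (simp add: powr_mult powr_minus field_simps)
    finally show "norm (2 ^ n * ?f (2 ^ n)) \<le> ln 2 powr (- \<beta>) * real n powr (- \<beta>)" by simp
  qed
  finally show ?thesis .
qed


lemma reciprocal_bounds: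
  fixes x y w :: real
  assumes "0 < x" "0 < y" "0 < w" "x \<le> y" "y / w \<le> x"
  shows "1 / y \<le> 1 / x \<and> 1 / x \<le> w / y"
  using assms by (simp add: field_simps)

lemma summable_of_eventually_le_inverse_square:
  fixes g :: "nat \<Rightarrow> real"
  assumes "\<forall>\<^sub>F n in sequentially. g n \<le> 1 / real n ^ 2" "\<And>n. 0 \<le> g n"
  shows "summable g"
proof (rule summable_comparison_test_ev)
  show "summable (\<lambda>n. 1 / real n ^ 2)"
    using inverse_power_summable[of 2, where 'a=real] by (simp add: divide_inverse)
  show "\<forall>\<^sub>F n in sequentially. norm (g n) \<le> 1 / real n ^ 2"
    using assms(1) by eventually_elim (use assms(2) in simp)
qed

text \<open>
  The scale is \<open>h = n\<^sup>\<alpha>\<close>: the number \<open>n / h\<close> of blocks grows polynomially as \<open>\<alpha> < 1\<close>, and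
  \<open>1 / (n h) = n powr (- (1 + \<alpha>))\<close> is summable as \<open>\<alpha> > 0\<close>.
\<close>

lemma (in random_flight) AE_transient_power_rate:
  assumes dim: "CARD('n) \<ge> 2" and \<alpha>: "0 < \<alpha>" "\<alpha> < 1" and r: "\<And>t. 0 < t \<Longrightarrow> r t = t powr (- \<alpha>)"
  shows "AE \<omega> in M. transient_path (\<lambda>t. walk \<tau> f t \<omega>)"
proof (rule AE_transient_of_rate[OF dim, where h="\<lambda>n. real n powr \<alpha>" and K="2 powr \<alpha>"])
  show "\<forall>\<^sub>F n in sequentially. 0 < real n powr \<alpha> \<and> 4 * real n powr \<alpha> \<le> real n"
    using four_powr_le[OF \<alpha>(2)] eventually_gt_at_top[of 0] by eventually_elim simp
  show "\<forall>\<^sub>F n in sequentially. \<forall>u\<in>{real n / 2..real n}. 1 / real n powr \<alpha> \<le> r u \<and> r u \<le> 2 powr \<alpha> / real n powr \<alpha>"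
    using eventually_gt_at_top[of 0]
  proof eventually_elim
    case (elim n)
    show ?case
    proof
      fix u assume u: "u \<in> {real n / 2..real n}"
      then have "0 < u" using elim by auto
      then have "r u = 1 / u powr \<alpha>" by (simp add: r powr_minus_divide)
      moreover have "u powr \<alpha> \<le> real n powr \<alpha>" using u \<open>0 < u\<close> \<alpha> by (intro powr_mono2) auto
      moreover have "real n powr \<alpha> / 2 powr \<alpha> \<le> u powr \<alpha>"
        using u elim \<alpha> by (subst powr_divide[symmetric]) (auto intro!: powr_mono2)
      ultimately show "1 / real n powr \<alpha> \<le> r u \<and> r u \<le> 2 powr \<alpha> / real n powr \<alpha>"
        using reciprocal_bounds[of "u powr \<alpha>" "real n powr \<alpha>" "2 powr \<alpha>"] \<open>0 < u\<close> elim by simp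
    qed
  qed
  show "summable (\<lambda>n. exp (- c * (real n / real n powr \<alpha>)))" if "0 < c" for c
    by (rule summable_of_eventually_le_inverse_square[OF exp_neg_powr_le[OF \<alpha>(2) that]]) simp
  have "1 / (real n * real n powr \<alpha>) = real n powr (- (1 + \<alpha>))" for n
    unfolding powr_minus_divide powr_add by simp
  then show "summable (\<lambda>n. 1 / (real n * real n powr \<alpha>))"
    using \<alpha> by (simp add: summable_real_powr_iff)
qed

text \<open>
  The scale is \<open>h = (ln (n + 1))\<^sup>\<beta>\<close>. The only series that is delicate is \<open>\<Sum> 1 / (n h)\<close>, which converges
  exactly for \<open>\<beta> > 1\<close>.
\<close>

lemma (in random_flight) AE_transient_log_rate:
  assumes dim: "CARD('n) \<ge> 2" and \<beta>: "1 < \<beta>" and r: "\<And>t. exp 1 \<le> t \<Longrightarrow> r t = ln t powr (- \<beta>)"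
  shows "AE \<omega> in M. transient_path (\<lambda>t. walk \<tau> f t \<omega>)"
proof (rule AE_transient_of_rate[OF dim, where h="\<lambda>n. ln (real n + 1) powr \<beta>" and K="2 powr \<beta>"])
  have \<beta>': "0 < \<beta>" using \<beta> by simp
  show "\<forall>\<^sub>F n in sequentially. 0 < ln (real n + 1) powr \<beta> \<and> 4 * ln (real n + 1) powr \<beta> \<le> real n"
    using four_ln_powr_le[OF \<beta>'] eventually_gt_at_top[of 0] by eventually_elim simp
  have "\<forall>\<^sub>F n in sequentially. exp 1 \<le> real n / 2" by real_asymp
  then show "\<forall>\<^sub>F n in sequentially. \<forall>u\<in>{real n / 2..real n}.
      1 / ln (real n + 1) powr \<beta> \<le> r u \<and> r u \<le> 2 powr \<beta> / ln (real n + 1) powr \<beta>"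
    using ln_half_ge
  proof eventually_elim
    case (elim n)
    show ?case
    proof
      fix u assume "u \<in> {real n / 2..real n}"
      then have u: "real n / 2 \<le> u" "u \<le> real n" by auto
      have e: "exp 1 \<le> u" using u elim(1) by linarith
      have u0: "0 < u" using e exp_gt_zero[of "1::real"] by linarith
      have n0: "0 < real n" using u u0 by linarith
      have lu: "1 \<le> ln u" using e u0 by (simp add: ln_ge_iff)
      have "ln u \<le> ln (real n + 1)" using u u0 n0 by (subst ln_le_cancel_iff) linarith+
      then have 1: "ln u powr \<beta> \<le> ln (real n + 1) powr \<beta>" using lu \<beta> by (intro powr_mono2) auto
      have "ln (real n / 2) \<le> ln u" using u u0 n0 by (subst ln_le_cancel_iff) linarith+
      then have "ln (real n + 1) / 2 \<le> ln u" using elim(2) by linarith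
      then have "(ln (real n + 1) / 2) powr \<beta> \<le> ln u powr \<beta>" using \<beta> n0 by (intro powr_mono2) auto
      then have 2: "ln (real n + 1) powr \<beta> / 2 powr \<beta> \<le> ln u powr \<beta>" using n0 by (simp add: powr_divide)
      have "r u = 1 / ln u powr \<beta>" using r[OF e] by (simp add: powr_minus_divide)
      then show "1 / ln (real n + 1) powr \<beta> \<le> r u \<and> r u \<le> 2 powr \<beta> / ln (real n + 1) powr \<beta>"
        using reciprocal_bounds[OF _ _ _ 1 2] lu n0 by simp
    qed
  qed
  show "summable (\<lambda>n. exp (- c * (real n / ln (real n + 1) powr \<beta>)))" if "0 < c" for c
    by (rule summable_of_eventually_le_inverse_square[OF exp_neg_log_le[OF that \<beta>']]) simp
  show "summable (\<lambda>n. 1 / (real n * ln (real n + 1) powr \<beta>))" by (rule summable_log[OF \<beta>])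
qed

theorem theorem4:
  fixes M :: "'w measure" and r :: "real \<Rightarrow> real"
    and \<tau> :: "nat \<Rightarrow> 'w \<Rightarrow> real" and f :: "nat \<Rightarrow> 'w \<Rightarrow> real ^ 'n"
  assumes dim: "CARD('n) \<ge> 2"
    and flight: "random_flight M r \<tau> f"
    and rate:
      "(\<exists>\<alpha>. 0 < \<alpha> \<and> \<alpha> < 1 \<and> (\<forall>t>0. r t = t powr (- \<alpha>))) \<or>
       (\<exists>\<beta>>2. \<forall>t\<ge>0. r t = (if t \<ge> exp 1 then (ln t) powr (- \<beta>) else 0))"
  shows "AE \<omega> in M. transient_path (\<lambda>t. walk \<tau> f t \<omega>)"
proof -
  interpret random_flight M r \<tau> f by (rule flight)
  from assms(3) show ?thesis
  proof (elim disjE exE conjE)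
    fix \<alpha> :: real assume "0 < \<alpha>" "\<alpha> < 1" "\<forall>t>0. r t = t powr (- \<alpha>)"
    then show ?thesis by (intro AE_transient_power_rate[OF dim]) auto
  next
    fix \<beta> :: real assume \<beta>: "2 < \<beta>" and r: "\<forall>t\<ge>0. r t = (if t \<ge> exp 1 then (ln t) powr (- \<beta>) else 0)"
    have "r t = ln t powr (- \<beta>)" if "exp 1 \<le> t" for t
      using r that exp_gt_zero[of "1::real"] by (simp add: order_trans[OF exp_ge_zero])
    with \<beta> show ?thesis by (intro AE_transient_log_rate[OF dim, of \<beta>]) auto
  qed
qed

end
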